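(* Let $\eta$ be a Poisson point process in $\mathbb R^d$ with locally finite, non-atomic, non-zero intensity measure $\mu$ (not necessarily finite). Let $F$ be a U-statistic of order $k$ with kernel $f\ge 0$. Assume that $F=F(\eta)$ is almost surely finite and that for some $\alpha\in[0,2)$ and $c>0$ we have almost surely $$\sum_{x\in\eta}F(x,\eta)^2\le c\,F(\eta)^\alpha .$$ Then for all $r\ge 0$, $$\mathbb P(F>\mathbb M F+r)\le 2\exp\left(-\frac{r^2}{4k^2c\,(r+\mathbb M F)^\alpha}\right),$$ $$\mathbb P(F<\mathbb M F-r)\le 2\exp\left(-\frac{r^2}{4k^2c\,(\mathbb M F)^\alpha}\right).$$
   Context: $\mathbf N$ is the set of locally finite subsets of $\mathbb R^d$, with the $\sigma$-algebra generated by the counting maps $\xi\mapsto\xi(A)=|\xi\cap A|$, $A$ Borel; $\eta$ is a random element of $\mathbf N$. For $\xi\in\mathbf N$, $\xi^k_{\neq}$ is the set of $k$-tuples of pairwise distinct points of $\xi$. A U-statistic of order $k$ with kernel $f$ is a functional $F(\xi)=\sum_{\mathbf x\in\xi^k_{\neq}}f(\mathbf x)$, $\xi\in\mathbf N$, where $f:(\mathbb R^d)^k\to\mathbb R$ is symmetric and measurable; one writes $F$ also for the random variable $F(\eta)$. Its local version is $F(x,\xi)=\sum_{\mathbf y\in(\xi\setminus\{x\})^{k-1}_{\neq}}f(x,\mathbf y)$ for $x\in\xi$. The smallest median of a real random variable $Z$ is $\mathbb M Z=\inf\{x\in\mathbb R:\mathbb P(Z\le x)\ge1/2\}$. Conventions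 for degenerate quotients: $0/0=0$, $s/0=\infty$ for $s>0$, $\exp(-\infty)=0$, and $0^0=1$. *)

theory Defs
  imports "HOL-Probability.Probability"
begin

section \<open>Point configurations and Poisson processes\<close>

definition loc_finite_sets :: "'a::euclidean_space set set" where
  "loc_finite_sets = {\<xi>. \<forall>B. bounded B \<longrightarrow> finite (\<xi> \<inter> B)}"

definition pts_in :: "'a set \<Rightarrow> 'a set \<Rightarrow> ennreal" where
  "pts_in \<xi> A = emeasure (count_space UNIV) (\<xi> \<inter> A)"

text \<open>The coarsest \<open>\<sigma>\<close>-algebra making all counting maps measurable.\<close>
definition config_space :: "'a::euclidean_space set measure" where
  "config_space =
     (SUP A \<in> sets borel. vimage_algebra loc_finite_sets (\<lambda>\<xi>. pts_in \<xi> A) borel)"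

definition loc_finite_measure :: "'a::euclidean_space measure \<Rightarrow> bool" where
  "loc_finite_measure \<mu> \<longleftrightarrow>
     sets \<mu> = sets borel \<and> (\<forall>B\<in>sets borel. bounded B \<longrightarrow> emeasure \<mu> B < \<infinity>)"

definition non_atomic :: "'a measure \<Rightarrow> bool" where
  "non_atomic \<mu> \<longleftrightarrow>
     (\<forall>A\<in>sets \<mu>. emeasure \<mu> A > 0 \<longrightarrow>
        (\<exists>B\<in>sets \<mu>. B \<subseteq> A \<and> 0 < emeasure \<mu> B \<and> emeasure \<mu> B < emeasure \<mu> A))"

text \<open>The Poisson distribution with parameter \<open>\<infinity>\<close> is the point mass at \<open>\<infinity>\<close>. The mass
  function is spelled out because \<^const>\<open>poisson_pmf\<close> does not cover the parameter \<open>0\<close>.\<close>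
definition poisson_process ::
    "'w measure \<Rightarrow> ('w \<Rightarrow> 'a::euclidean_space set) \<Rightarrow> 'a measure \<Rightarrow> bool" where
  "poisson_process P \<eta> \<mu> \<longleftrightarrow>
     prob_space P \<and> \<eta> \<in> measurable P config_space \<and>
     (\<forall>A\<in>sets borel. emeasure \<mu> A < \<infinity> \<longrightarrow>
        (\<forall>n::nat. measure P {\<omega> \<in> space P. pts_in (\<eta> \<omega>) A = of_nat n}
                  = measure \<mu> A ^ n / fact n * exp (- measure \<mu> A))) \<and>
     (\<forall>A\<in>sets borel. emeasure \<mu> A = \<infinity> \<longrightarrow> (AE \<omega> in P. pts_in (\<eta> \<omega>) A = \<infinity>)) \<and>
     (\<forall>(m::nat) A. (\<forall>i<m. A i \<in> sets borel) \<longrightarrow> disjoint_family_on A {..<m} \<longrightarrow>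
        prob_space.indep_vars P (\<lambda>_. borel) (\<lambda>i \<omega>. pts_in (\<eta> \<omega>) (A i)) {..<m})"

section \<open>U-statistics\<close>

text \<open>A \<open>k\<close>-tuple is an extensional function on \<open>{..<k}\<close>; accordingly \<open>(\<real>\<^sup>d)\<^sup>k\<close> is
  \<open>PiM {..<k} (\<lambda>_. borel)\<close>.\<close>
definition distinct_tuples :: "nat \<Rightarrow> 'a set \<Rightarrow> (nat \<Rightarrow> 'a) set" where
  "distinct_tuples k \<xi> = {x \<in> {..<k} \<rightarrow>\<^sub>E \<xi>. inj_on x {..<k}}"

definition sym_kernel :: "nat \<Rightarrow> ((nat \<Rightarrow> 'a::euclidean_space) \<Rightarrow> real) \<Rightarrow> bool" where
  "sym_kernel k f \<longleftrightarrow>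
     f \<in> borel_measurable (PiM {..<k} (\<lambda>_. borel)) \<and>
     (\<forall>x \<in> {..<k} \<rightarrow>\<^sub>E UNIV. \<forall>\<sigma>. \<sigma> permutes {..<k} \<longrightarrow> f (x \<circ> \<sigma>) = f x)"

text \<open>For nonnegative kernels the sums always exist in \<open>[0,\<infinity>]\<close>; negative values of \<open>f\<close> would be
  truncated by \<^const>\<open>ennreal\<close>, so these definitions are meant for \<open>f \<ge> 0\<close> only.\<close>
definition U_stat :: "nat \<Rightarrow> ((nat \<Rightarrow> 'a) \<Rightarrow> real) \<Rightarrow> 'a set \<Rightarrow> ennreal" where
  "U_stat k f \<xi> = (\<Sum>\<^sub>\<infinity>x\<in>distinct_tuples k \<xi>. ennreal (f x))"

text \<open>For \<open>k \<ge> 1\<close>, \<open>case_nat x y\<close> is the \<open>k\<close>-tuple \<open>(x, y 0, \<dots>, y (k - 2))\<close>; it is again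
  extensional.\<close>
definition U_stat_local :: "nat \<Rightarrow> ((nat \<Rightarrow> 'a) \<Rightarrow> real) \<Rightarrow> 'a \<Rightarrow> 'a set \<Rightarrow> ennreal" where
  "U_stat_local k f x \<xi> =
     (\<Sum>\<^sub>\<infinity>y\<in>distinct_tuples (k - 1) (\<xi> - {x}). ennreal (f (case_nat x y)))"

section \<open>Medians and conventions for degenerate expressions\<close>

definition smallest_median :: "'w measure \<Rightarrow> ('w \<Rightarrow> real) \<Rightarrow> real" where
  "smallest_median P Z = Inf {x. measure P {\<omega> \<in> space P. Z \<omega> \<le> x} \<ge> 1 / 2}"

text \<open>\<^const>\<open>powr\<close> with the convention \<open>0\<^sup>0 = 1\<close>.\<close>
definition rpow :: "real \<Rightarrow> real \<Rightarrow> real" where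
  "rpow x a = (if a = 0 then 1 else x powr a)"

text \<open>\<open>exp (- s / t)\<close> for \<open>s, t \<ge> 0\<close>, where the quotient is taken in \<^typ>\<open>ereal\<close>, which has
  \<open>0 / 0 = 0\<close> and \<open>s / 0 = \<infinity>\<close> for \<open>s > 0\<close>, and \<open>exp (- \<infinity>) = 0\<close>.\<close>
definition exp_neg_quot :: "real \<Rightarrow> real \<Rightarrow> real" where
  "exp_neg_quot s t =
     (let q = ereal s / ereal t in if q = \<infinity> then 0 else exp (- real_of_ereal q))"

end

theory Submission
  imports Defs
begin

text \<open>
  For finite configurations and \<open>f \<ge> 0\<close> symmetric,
  \<open>F(\<xi>) - F(\<zeta>) \<le> k \<Sum> F(x,\<xi>)\<close>, the sum running over \<open>x \<in> \<xi> - \<zeta>\<close>, because every tuple counted in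
  \<open>F(\<xi>)\<close> but not in \<open>F(\<zeta>)\<close> has a coordinate outside \<open>\<zeta>\<close>. So \<open>F(\<xi>) - b > s k sqrt(\<Sum> F(x,\<xi>)\<^sup>2)\<close>
  forces the convex distance of \<open>\<xi>\<close> to \<open>{F \<le> b}\<close> to be at least \<open>s\<close>, and Talagrand's inequality gives
  \<open>P(F \<le> b) P(F > b + s k sqrt(\<Sum> F(x,\<eta>)\<^sup>2)) \<le> exp(- s\<^sup>2/4)\<close>. Talagrand's inequality for product measures
  suffices: inside a ball the process is cut into cells of small intensity, whose contents are
  independent, and with high probability no cell holds two points; then the ball grows. Both
  tail bounds follow with \<open>b\<close> the median, respectively the median minus \<open>r\<close>: after bounding the sum
  of squares by \<open>c F\<^sup>\<alpha>\<close>, use that \<open>t \<mapsto> (t - b) t powr (- \<alpha>/2)\<close> is increasing on \<open>t > b \<ge> 0\<close> for \<open>\<alpha> < 2\<close>.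
\<close>

section \<open>Talagrand's inequality for product measures\<close>

text \<open>Talagrand's distance allows weights that depend on the point of the upper set but not on
  its competitor in the lower set. The values \<open>F(z, \<xi>)\<close>, divided by the root of
  their sum of squares, are such weights; hence the sum of squares is evaluated at the configuration
  with the large value of \<open>F\<close>, and the almost sure bound can be inserted there. The
  distance to a set is built from suprema and infima over uncountable families, so its measurability
  is delicate. It is therefore never formed: two measurable sets are given, a weight vector is
  exhibited for each point of the second one, and the induction over coordinates is phrased with
  such witnesses too. Cells with several points have to be excluded because weights are normalised
  per coordinate: such a cell would contribute the square of the sum of its local values instead of
  the sum of their squares. In the final exponent the 4 is Talagrand's constant and comes from a
  scalar inequality for one coordinate, while \<open>k^2\<close> comes from the \<open>k\<close>
  positions that a point can take in a tuple.\<close>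

lemma exp_two_point_le:
  fixes t :: real
  assumes "0 \<le> t"
  shows "exp (t - t\<^sup>2) + exp (- t) \<le> 2"
proof -
  have "exp (0 - 0\<^sup>2) + exp (- 0) \<ge> exp (t - t\<^sup>2) + exp (- t)"
  proof (rule DERIV_nonpos_imp_nonincreasing[OF assms])
    fix x :: real
    have "((\<lambda>x. exp (x - x\<^sup>2) + exp (- x)) has_real_derivative
        (1 - 2 * x) * exp (x - x\<^sup>2) - exp (- x)) (at x)"
      by (auto intro!: derivative_eq_intros)
    moreover have "(1 - 2 * x) * exp (x - x\<^sup>2) \<le> exp (- 2 * x) * exp (x - x\<^sup>2)"
      using exp_ge_add_one_self[of "- 2 * x"] by (intro mult_right_mono) auto
    moreover have "exp (- 2 * x) * exp (x - x\<^sup>2) \<le> exp (- x)"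
      by (simp flip: exp_add)
    ultimately show "\<exists>y. ((\<lambda>x. exp (x - x\<^sup>2) + exp (- x)) has_real_derivative y) (at x) \<and> y \<le> 0"
      by (intro exI[of _ "(1 - 2 * x) * exp (x - x\<^sup>2) - exp (- x)"]) linarith
  qed
  then show ?thesis by simp
qed

text \<open>With \<open>r = exp (- t)\<close> and \<open>1 - l\<close> in place of \<open>l\<close>
  this is the classical scalar inequality of Talagrand's induction, which bounds the infimum of
  \<open>r powr (- l) * exp ((1 - l)^2 / 4)\<close> by \<open>2 - r\<close>. The exponent is minimal
  at \<open>l = 2 * t\<close>, with value \<open>t - t^2\<close>. Beyond \<open>t = 1/2\<close> this
  choice leaves the unit interval, and \<open>l = 1\<close> takes over with exponent 1/4, the value
  reached at \<open>t = 1/2\<close>.\<close>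

lemma exp_convex_cost_le:
  fixes t :: real
  assumes "0 \<le> t"
  obtains l where "0 \<le> l" "l \<le> 1" "exp ((1 - l) * t + l\<^sup>2 / 4) \<le> 2 - exp (- t)"
proof (cases "t \<le> 1/2")
  case True
  show ?thesis
    by (rule that[of "2 * t"])
      (use True assms exp_two_point_le[OF assms] in \<open>auto simp: algebra_simps power2_eq_square\<close>)
next
  case False
  have "exp (1/4) + exp (- t) \<le> exp (1/4) + exp (- (1/2::real))"
    using False by simp
  also have "\<dots> \<le> 2"
    using exp_two_point_le[of "1/2"] by (simp add: power2_eq_square)
  finally show ?thesis
    by (intro that[of 1]) auto
qed

lemma exp_weighted_sum_le:
  fixes a t :: "'i \<Rightarrow> real"
  assumes "\<And>j. j \<in> J \<Longrightarrow> a j \<ge> 0" "sum a J = 1"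
  shows "exp (\<Sum>j\<in>J. a j * t j) \<le> (\<Sum>j\<in>J. a j * exp (t j))"
proof -
  have "finite J" using assms(2) by (metis sum.infinite zero_neq_one)
  then show ?thesis
    using convex_on_sum[of J UNIV exp a t] assms exp_convex by (cases "J = {}") auto
qed

text \<open>The points \<open>\<omega>' j\<close> can be pushed towards the infimum
  \<open>m j\<close> of \<open>G j\<close>, after which \<open>l j\<close> is chosen by the scalar
  inequality with \<open>t = G j \<omega> - m j\<close>. Integration then leaves expressions
  \<open>u * (2 - u) \<le> 1\<close>, where \<open>u\<close> is \<open>exp (m j)\<close> times the
  integral of \<open>exp (- G j)\<close>.\<close>

lemma talagrand_one_dim:
  fixes N :: "'b measure" and G :: "'i \<Rightarrow> 'b \<Rightarrow> real" and h :: "'b \<Rightarrow> ennreal"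
  assumes "prob_space N"
    and a: "\<And>j. j \<in> J \<Longrightarrow> a j \<ge> 0" "sum a J = 1"
    and G: "\<And>j. j \<in> J \<Longrightarrow> G j \<in> borel_measurable N"
    and T: "\<And>j \<omega>. j \<in> J \<Longrightarrow> \<omega> \<in> space N \<Longrightarrow> \<bar>G j \<omega>\<bar> \<le> T"
    and h: "\<And>\<omega> \<omega>' l. \<omega> \<in> space N \<Longrightarrow> (\<And>j. j \<in> J \<Longrightarrow> \<omega>' j \<in> space N \<and> 0 \<le> l j \<and> l j \<le> 1) \<Longrightarrow>
       h \<omega> \<le> ennreal (exp (\<Sum>j\<in>J. a j * (l j * G j (\<omega>' j) + (1 - l j) * G j \<omega> + (l j)\<^sup>2 / 4)))"
  shows "(\<integral>\<^sup>+\<omega>. h \<omega> \<partial>N) \<le> ennreal (exp (\<Sum>j\<in>J. a j * - ln (\<integral>\<omega>. exp (- G j \<omega>) \<partial>N)))"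
proof -
  interpret prob_space N by fact
  have fin: "finite J" using a(2) by (metis sum.infinite zero_neq_one)
  define m where "m j = Inf (G j ` space N)" for j
  define I where "I j = (\<integral>\<omega>. exp (- G j \<omega>) \<partial>N)" for j
  define L where "L j = - ln (I j)" for j
  have bdd: "bdd_below (G j ` space N)" if "j \<in> J" for j
    using T[OF that] by (intro bdd_belowI2[of _ "-T"]) force
  have m_le: "m j \<le> G j \<omega>" if "j \<in> J" "\<omega> \<in> space N" for j \<omega>
    unfolding m_def using that bdd by (auto intro: cINF_lower)
  have int: "integrable N (\<lambda>\<omega>. exp (- G j \<omega>))" if "j \<in> J" for j
    using T[OF that] G[OF that]
    by (intro integrable_const_bound[where B="exp T"] AE_I2) (auto, fastforce)
  have I_pos: "I j > 0" if "j \<in> J" for j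
  proof -
    have "exp (- T) = (\<integral>\<omega>. exp (- T) \<partial>N)" by (simp add: prob_space)
    also have "\<dots> \<le> I j"
      unfolding I_def using int[OF that] T[OF that] by (intro integral_mono) (auto, fastforce)
    finally show ?thesis by (rule less_le_trans[OF exp_gt_zero])
  qed
  \<comment> \<open>Dividing by \<open>exp (L j)\<close> before convexity of \<open>exp\<close> is
    used turns a weighted geometric mean into a weighted arithmetic mean of functions that each have
    integral at most 1. This takes the place of Hoelder's inequality.\<close>
  define \<psi> where "\<psi> j \<omega> = exp (m j - L j) * (2 - exp (m j) * exp (- G j \<omega>))" for j \<omega>
  have \<psi>_nonneg: "\<psi> j \<omega> \<ge> 0" if "j \<in> J" "\<omega> \<in> space N" for j \<omega>
  proof -
    have "exp (m j) * exp (- G j \<omega>) \<le> 1"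
      using m_le[OF that] by (simp flip: exp_add)
    then show ?thesis unfolding \<psi>_def by (intro mult_nonneg_nonneg) auto
  qed
  have int\<psi>: "integrable N (\<psi> j)" if "j \<in> J" for j
    unfolding \<psi>_def using int[OF that] by auto
  have \<psi>_int: "(\<integral>\<omega>. \<psi> j \<omega> \<partial>N) \<le> 1" if "j \<in> J" for j
  proof -
    have "(\<integral>\<omega>. \<psi> j \<omega> \<partial>N) = exp (m j - L j) * (2 - exp (m j) * I j)"
      using int[OF that] unfolding \<psi>_def I_def by (simp add: prob_space)
    also have "exp (m j - L j) = exp (m j) * I j"
      using I_pos[OF that] by (simp add: L_def exp_add)
    also have "exp (m j) * I j * (2 - exp (m j) * I j) \<le> 1"
      using zero_le_power2[of "1 - exp (m j) * I j"] by (simp add: power2_eq_square algebra_simps)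
    finally show ?thesis .
  qed
  have h_le: "h \<omega> \<le> ennreal (exp (\<Sum>j\<in>J. a j * L j)) * (\<Sum>j\<in>J. ennreal (a j) * ennreal (\<psi> j \<omega>))"
    if \<omega>: "\<omega> \<in> space N" for \<omega>
  proof -
    define R where "R = exp (\<Sum>j\<in>J. a j * L j) * (\<Sum>j\<in>J. a j * \<psi> j \<omega>)"
    have "\<exists>l. 0 \<le> l \<and> l \<le> 1 \<and> exp ((1 - l) * (G j \<omega> - m j) + l\<^sup>2 / 4) \<le> 2 - exp (- (G j \<omega> - m j))"
      if "j \<in> J" for j
      using exp_convex_cost_le[of "G j \<omega> - m j"] m_le[OF that \<omega>] by (metis diff_ge_0_iff_ge)
    then obtain l where l: "\<And>j. j \<in> J \<Longrightarrow> 0 \<le> l j" "\<And>j. j \<in> J \<Longrightarrow> l j \<le> 1"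
      "\<And>j. j \<in> J \<Longrightarrow> exp ((1 - l j) * (G j \<omega> - m j) + (l j)\<^sup>2 / 4) \<le> 2 - exp (- (G j \<omega> - m j))"
      by metis
    \<comment> \<open>The infimum \<open>m j\<close> may not be attained, so
      \<open>\<omega>' j\<close> is taken within \<open>e\<close> of it; the loss disappears as
      \<open>e\<close> tends to 0.\<close>
    have "h \<omega> \<le> ennreal (exp e * R)" if e: "0 < e" for e
    proof -
      have "\<exists>\<omega>'\<in>space N. G j \<omega>' < m j + e" if j: "j \<in> J" for j
        using e cInf_less_iff[of "G j ` space N" "m j + e"] bdd[OF j] not_empty
        by (auto simp: m_def)
      then obtain \<omega>' where \<omega>': "\<And>j. j \<in> J \<Longrightarrow> \<omega>' j \<in> space N" "\<And>j. j \<in> J \<Longrightarrow> G j (\<omega>' j) < m j + e"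
        by metis
      define q where "q j = l j * G j (\<omega>' j) + (1 - l j) * G j \<omega> + (l j)\<^sup>2 / 4" for j
      have q: "exp (q j - e - L j) \<le> \<psi> j \<omega>" if j: "j \<in> J" for j
      proof -
        have "l j * G j (\<omega>' j) \<le> l j * (m j + e)"
          using l[OF j] \<omega>'[OF j] by (intro mult_left_mono) auto
        also have "\<dots> \<le> l j * m j + e"
          using l[OF j] e by (simp add: distrib_left mult_left_le_one_le)
        finally have "q j - e - L j \<le> (m j - L j) + ((1 - l j) * (G j \<omega> - m j) + (l j)\<^sup>2 / 4)"
          unfolding q_def by (simp add: algebra_simps)
        then have "exp (q j - e - L j) \<le> exp (m j - L j) * exp ((1 - l j) * (G j \<omega> - m j) + (l j)\<^sup>2 / 4)"
          by (simp flip: exp_add)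
        also have "\<dots> \<le> exp (m j - L j) * (2 - exp (- (G j \<omega> - m j)))"
          using l(3)[OF j] by (intro mult_left_mono) auto
        also have "exp (- (G j \<omega> - m j)) = exp (m j) * exp (- G j \<omega>)"
          by (simp flip: exp_add)
        finally show ?thesis unfolding \<psi>_def .
      qed
      have "exp (\<Sum>j\<in>J. a j * (q j - e - L j)) \<le> (\<Sum>j\<in>J. a j * exp (q j - e - L j))"
        by (rule exp_weighted_sum_le) (use a in auto)
      also have "\<dots> \<le> (\<Sum>j\<in>J. a j * \<psi> j \<omega>)"
        using q a by (intro sum_mono mult_left_mono) auto
      finally have "exp (e + (\<Sum>j\<in>J. a j * L j)) * exp (\<Sum>j\<in>J. a j * (q j - e - L j)) \<le> exp e * R"
        by (simp add: R_def exp_add)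
      moreover have "(\<Sum>j\<in>J. a j * e) = e"
        using a(2) by (simp flip: sum_distrib_right)
      then have "e + (\<Sum>j\<in>J. a j * L j) + (\<Sum>j\<in>J. a j * (q j - e - L j)) = (\<Sum>j\<in>J. a j * q j)"
        by (simp add: algebra_simps sum.distrib sum_subtractf)
      ultimately have "exp (\<Sum>j\<in>J. a j * q j) \<le> exp e * R"
        by (simp flip: exp_add)
      moreover have "h \<omega> \<le> ennreal (exp (\<Sum>j\<in>J. a j * q j))"
        unfolding q_def using \<omega> \<omega>' l by (intro h) auto
      ultimately show ?thesis
        by (meson ennreal_leI order_trans)
    qed
    moreover have "((\<lambda>e. ennreal (exp e * R)) \<longlongrightarrow> ennreal (exp 0 * R)) (at_right 0)"
      by (intro tendsto_ennrealI tendsto_intros)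
    moreover have "eventually (\<lambda>e::real. 0 < e) (at_right 0)"
      by (rule eventually_at_right_less)
    ultimately have "h \<omega> \<le> ennreal (exp 0 * R)"
      by (intro tendsto_lowerbound[of "\<lambda>e. ennreal (exp e * R)" _ "at_right 0"])
        (auto elim: eventually_mono)
    then have "h \<omega> \<le> ennreal R" by simp
    also have "ennreal R = ennreal (exp (\<Sum>j\<in>J. a j * L j)) * (\<Sum>j\<in>J. ennreal (a j) * ennreal (\<psi> j \<omega>))"
    proof -
      have "ennreal R = ennreal (exp (\<Sum>j\<in>J. a j * L j)) * ennreal (\<Sum>j\<in>J. a j * \<psi> j \<omega>)"
        unfolding R_def using a \<psi>_nonneg \<omega> by (intro ennreal_mult) (auto intro!: sum_nonneg)
      also have "ennreal (\<Sum>j\<in>J. a j * \<psi> j \<omega>) = (\<Sum>j\<in>J. ennreal (a j * \<psi> j \<omega>))"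
        using a \<psi>_nonneg \<omega> by (intro sum_ennreal[symmetric]) auto
      also have "\<dots> = (\<Sum>j\<in>J. ennreal (a j) * ennreal (\<psi> j \<omega>))"
        using a \<psi>_nonneg \<omega> by (intro sum.cong refl ennreal_mult) auto
      finally show ?thesis .
    qed
    finally show ?thesis .
  qed
  have "(\<integral>\<^sup>+\<omega>. h \<omega> \<partial>N) \<le>
      (\<integral>\<^sup>+\<omega>. ennreal (exp (\<Sum>j\<in>J. a j * L j)) * (\<Sum>j\<in>J. ennreal (a j) * ennreal (\<psi> j \<omega>)) \<partial>N)"
    using h_le by (intro nn_integral_mono) auto
  also have "\<dots> = ennreal (exp (\<Sum>j\<in>J. a j * L j)) * (\<Sum>j\<in>J. ennreal (a j) * (\<integral>\<^sup>+\<omega>. ennreal (\<psi> j \<omega>) \<partial>N))"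
    using int\<psi> by (simp add: nn_integral_cmult nn_integral_sum)
  also have "\<dots> \<le> ennreal (exp (\<Sum>j\<in>J. a j * L j)) * (\<Sum>j\<in>J. ennreal (a j) * 1)"
    using \<psi>_int int\<psi> \<psi>_nonneg
    by (intro mult_left_mono sum_mono) (auto simp: nn_integral_eq_integral)
  also have "(\<Sum>j\<in>J. ennreal (a j) * 1) = 1"
    using a by (simp add: sum_ennreal)
  finally show ?thesis
    by (simp add: L_def I_def)
qed

section \<open>Induction over the coordinates of a finite product\<close>

lemma sum_prod_encode_two:
  fixes \<Phi> :: "nat \<times> nat \<Rightarrow> real"
  assumes "finite J"
  shows "(\<Sum>n\<in>prod_encode ` (J \<times> {0, 1}). \<Phi> (prod_decode n)) = (\<Sum>j\<in>J. \<Phi> (j, 0) + \<Phi> (j, 1))"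
proof -
  have "(\<Sum>n\<in>prod_encode ` (J \<times> {0, 1}). \<Phi> (prod_decode n)) = (\<Sum>p\<in>J \<times> {0, 1}. \<Phi> p)"
    by (subst sum.reindex) (auto intro: inj_prod_encode)
  also have "\<dots> = (\<Sum>j\<in>J. \<Sum>b\<in>{0, 1}. \<Phi> (j, b))"
    using assms by (subst sum.cartesian_product) (simp add: case_prod_unfold)
  finally show ?thesis by simp
qed

lemma integral_PiM_insert_rev:
  fixes f :: "('c \<Rightarrow> 'b) \<Rightarrow> real"
  assumes M: "\<And>i. prob_space (M i)" and I: "finite I" "i \<notin> I"
    and f: "f \<in> borel_measurable (PiM (insert i I) M)"
    and B: "\<And>x. x \<in> space (PiM (insert i I) M) \<Longrightarrow> 0 \<le> f x \<and> f x \<le> B"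
  shows "(\<integral>x. f x \<partial>PiM (insert i I) M) = (\<integral>y. (\<integral>x. f (x(i := y)) \<partial>PiM I M) \<partial>M i)"
proof -
  interpret product_sigma_finite M
    by (intro product_sigma_finite.intro prob_space_imp_sigma_finite M)
  interpret PI: prob_space "PiM (insert i I) M" by (intro prob_space_PiM M)
  have PP: "prob_space (PiM I M \<Otimes>\<^sub>M M i)"
    by (intro prob_space_pair prob_space_PiM M)
  have int: "integrable (PiM (insert i I) M) f"
    using B by (intro PI.integrable_const_bound[where B=B] AE_I2 f) auto
  have upd: "x(i := y) \<in> space (PiM (insert i I) M)" if "x \<in> space (PiM I M)" "y \<in> space (M i)" for x y
    using that by (simp add: space_PiM PiE_fun_upd)
  have meas: "(\<lambda>(x, y). f (x(i := y))) \<in> borel_measurable (PiM I M \<Otimes>\<^sub>M M i)"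
    using measurable_compose[OF measurable_add_dim f] by (simp add: case_prod_unfold comp_def)
  have "integrable (PiM I M \<Otimes>\<^sub>M M i) (\<lambda>(x, y). f (x(i := y)))"
    using B upd
    by (intro finite_measure.integrable_const_bound[where B=B] prob_space.finite_measure[OF PP] AE_I2 meas) (auto simp: space_pair_measure)
  note fubini = pair_sigma_finite.Fubini_integral[OF _ this]
  have "pair_sigma_finite (PiM I M) (M i)"
    by (intro pair_sigma_finite.intro prob_space_imp_sigma_finite prob_space_PiM M)
  from fubini[OF this] show ?thesis
    unfolding product_integral_insert[OF I int] by (rule sym)
qed

text \<open>The condition on \<^term>\<open>h\<close> is a linearised form of \<open>h \<le> \<Sum>\<^sub>j a\<^sub>j Q g\<^sub>j\<close>, where \<open>Q g x\<close> is the
  infimum over probability measures \<open>\<nu>\<close> of \<open>\<integral> g \<partial>\<nu> + 1/4 \<Sum>\<^sub>i \<nu>(y\<^sub>i \<noteq> x\<^sub>i)\<^sup>2\<close>. Only \<^term>\<open>g\<close> and \<^term>\<open>h\<close> need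
  to be measurable, not \<open>Q g\<close>; the price is that a whole family of functions has to be carried
  through the induction.\<close>
lemma talagrand_family:
  fixes M :: "'c \<Rightarrow> 'b measure" and J :: "nat set" and g :: "nat \<Rightarrow> ('c \<Rightarrow> 'b) \<Rightarrow> real"
  assumes M: "\<And>i. prob_space (M i)" and "finite I"
    and "\<And>j. j \<in> J \<Longrightarrow> a j \<ge> 0" "sum a J = 1"
    and "\<And>j. j \<in> J \<Longrightarrow> g j \<in> borel_measurable (PiM I M)"
    and "\<And>j x. j \<in> J \<Longrightarrow> x \<in> space (PiM I M) \<Longrightarrow> \<bar>g j x\<bar> \<le> T"
    and "h \<in> borel_measurable (PiM I M)"
    and "\<And>x. x \<in> space (PiM I M) \<Longrightarrow> \<exists>c. (\<forall>i\<in>I. c i \<ge> 0) \<and>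
       (\<forall>y. (\<forall>j\<in>J. y j \<in> space (PiM I M)) \<longrightarrow>
          h x + (\<Sum>i\<in>I. (c i)\<^sup>2) \<le> (\<Sum>j\<in>J. a j * (g j (y j) + (\<Sum>i\<in>I. if y j i \<noteq> x i then c i else 0))))"
  shows "(\<integral>\<^sup>+x. ennreal (exp (h x)) \<partial>PiM I M)
     \<le> ennreal (exp (\<Sum>j\<in>J. a j * - ln (\<integral>x. exp (- g j x) \<partial>PiM I M)))"
  using assms(2-)
proof (induction I arbitrary: J a g h rule: finite_induct)
  case empty
  obtain c where "\<forall>y. (\<forall>j\<in>J. y j \<in> space (PiM {} M)) \<longrightarrow>
     h (\<lambda>_. undefined) \<le> (\<Sum>j\<in>J. a j * g j (y j))"
    using empty(6)[of "\<lambda>_. undefined"] by (auto simp: space_PiM)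
  from this[rule_format, of "\<lambda>_ _. undefined"]
  have "h (\<lambda>_. undefined) \<le> (\<Sum>j\<in>J. a j * g j (\<lambda>_. undefined))"
    by (simp add: space_PiM)
  then show ?case
    by (simp add: PiM_empty nn_integral_count_space_finite lebesgue_integral_count_space_finite)
next
  case (insert i I J a g h)
  interpret product_sigma_finite M
    by (intro product_sigma_finite.intro prob_space_imp_sigma_finite M)
  interpret QI: prob_space "PiM I M" by (intro prob_space_PiM M)
  note a = insert.prems(1,2) and g = insert.prems(3) and T = insert.prems(4)
    and h = insert.prems(5) and cond = insert.prems(6)
  have fin: "finite J" using a(2) by (metis sum.infinite zero_neq_one)
  have upd: "x(i := y) \<in> space (PiM (insert i I) M)" if "x \<in> space (PiM I M)" "y \<in> space (M i)" for x y
    using that by (simp add: space_PiM PiE_fun_upd)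
  have upd_meas: "(\<lambda>x. x(i := y)) \<in> measurable (PiM I M) (PiM (insert i I) M)" if "y \<in> space (M i)" for y
    using measurable_compose[OF measurable_Pair2'[OF that] measurable_add_dim[of i I M]] by simp
  have g_upd: "(\<lambda>x. g j (x(i := y))) \<in> borel_measurable (PiM I M)"
    if "j \<in> J" "y \<in> space (M i)" for j y
    by (rule measurable_compose[OF upd_meas g]) (use that in auto)
  \<comment> \<open>Averaging \<open>exp (- g j)\<close> over the old coordinates leaves a function
    \<open>G j\<close> of the new one, and integrating \<open>exp (- G j)\<close> restores the full
    integral of \<open>exp (- g j)\<close>. In this form the one-coordinate bound composes with the
    induction hypothesis.\<close>
  define E where "E j \<omega> = (\<integral>x. exp (- g j (x(i := \<omega>))) \<partial>PiM I M)" for j \<omega>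
  define G where "G j \<omega> = - ln (E j \<omega>)" for j \<omega>
  have E_meas: "E j \<in> borel_measurable (M i)" if "j \<in> J" for j
  proof -
    have "(\<lambda>p. exp (- g j ((\<lambda>(x, y). x(i := y)) p))) \<in> borel_measurable (PiM I M \<Otimes>\<^sub>M M i)"
      using measurable_compose[OF measurable_add_dim g[OF that]] by measurable
    then have "(\<lambda>(y, x). exp (- g j (x(i := y)))) \<in> borel_measurable (M i \<Otimes>\<^sub>M PiM I M)"
      by (subst measurable_pair_swap_iff) (simp add: case_prod_beta)
    then show ?thesis unfolding E_def
      by (rule QI.borel_measurable_lebesgue_integral)
  qed
  have E_bounds: "exp (- T) \<le> E j \<omega>" "E j \<omega> \<le> exp T" if j: "j \<in> J" and \<omega>: "\<omega> \<in> space (M i)" for j \<omega>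
  proof -
    have *: "exp (- T) \<le> exp (- g j (x(i := \<omega>)))" "exp (- g j (x(i := \<omega>))) \<le> exp T"
      if "x \<in> space (PiM I M)" for x
      using T[of j "x(i := \<omega>)"] upd[OF that \<omega>] j by (auto simp del: fun_upd_apply)
    have int: "integrable (PiM I M) (\<lambda>x. exp (- g j (x(i := \<omega>))))"
      using * g_upd[OF j \<omega>] by (intro QI.integrable_const_bound[where B="exp T"] AE_I2) auto
    show "exp (- T) \<le> E j \<omega>" unfolding E_def
      using int * by (intro QI.integral_ge_const AE_I2) auto
    show "E j \<omega> \<le> exp T" unfolding E_def
      using int * by (intro QI.integral_le_const AE_I2) auto
  qed
  have E_pos: "0 < E j \<omega>" if "j \<in> J" "\<omega> \<in> space (M i)" for j \<omega>
    using E_bounds(1)[OF that] by (rule less_le_trans[OF exp_gt_zero])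
  have "(\<integral>\<^sup>+x. ennreal (exp (h x)) \<partial>PiM (insert i I) M) =
      (\<integral>\<^sup>+\<omega>. (\<integral>\<^sup>+x. ennreal (exp (h (x(i := \<omega>)))) \<partial>PiM I M) \<partial>M i)"
    using insert h by (intro product_nn_integral_insert_rev) auto
  also have "\<dots> \<le> ennreal (exp (\<Sum>j\<in>J. a j * - ln (\<integral>\<omega>. exp (- G j \<omega>) \<partial>M i)))"
  proof (rule talagrand_one_dim[where T=T, OF M a])
    fix j assume j: "j \<in> J"
    show "G j \<in> borel_measurable (M i)"
      unfolding G_def using E_meas[OF j] by measurable
    fix \<omega> assume \<omega>: "\<omega> \<in> space (M i)"
    have "ln (exp (- T)) \<le> ln (E j \<omega>)" "ln (E j \<omega>) \<le> ln (exp T)"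
      using E_bounds[OF j \<omega>] E_pos[OF j \<omega>] by (auto simp del: ln_exp)
    then show "\<bar>G j \<omega>\<bar> \<le> T" by (simp add: G_def)
  next
    fix \<omega> and \<omega>' :: "nat \<Rightarrow> 'b" and l :: "nat \<Rightarrow> real"
    assume \<omega>: "\<omega> \<in> space (M i)"
      and \<omega>l: "\<And>j. j \<in> J \<Longrightarrow> \<omega>' j \<in> space (M i) \<and> 0 \<le> l j \<and> l j \<le> 1"
    \<comment> \<open>Each \<open>j\<close> splits into two test functions: copy 0 keeps the new
      coordinate at \<open>\<omega>\<close> and has weight \<open>1 - l j\<close>, copy 1 moves it
      to \<open>\<omega>' j\<close> and has weight \<open>l j\<close>. The doubled index set is
      coded back into the naturals because the induction hypothesis speaks of sets of
      naturals.\<close>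
    define J' where "J' = prod_encode ` (J \<times> {0, 1::nat})"
    define w where "w p = (if snd p = 0 then \<omega> else \<omega>' (fst p))" for p :: "nat \<times> nat"
    define a' where "a' n = (case prod_decode n of (j, b) \<Rightarrow> a j * (if b = 0 then 1 - l j else l j))" for n
    define g' where "g' n x = g (fst (prod_decode n)) (x(i := w (prod_decode n)))" for n x
    \<comment> \<open>The price of the moves in the new coordinate. It is subtracted from
      \<open>h\<close> to meet the induction hypothesis, and the factor \<open>exp D\<close> puts it
      back at the end.\<close>
    define D where "D = (\<Sum>j\<in>J. a j * (l j)\<^sup>2 / 4)"
    define h' where "h' x = h (x(i := \<omega>)) - D" for x
    have w: "w (prod_decode n) \<in> space (M i)" "fst (prod_decode n) \<in> J" if "n \<in> J'" for n
      using that \<omega> \<omega>l by (auto simp: J'_def w_def)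
    have sum_J': "(\<Sum>n\<in>J'. a' n * \<phi> n) =
        (\<Sum>j\<in>J. a j * ((1 - l j) * \<phi> (prod_encode (j, 0)) + l j * \<phi> (prod_encode (j, 1))))"
      for \<phi> :: "nat \<Rightarrow> real"
      using sum_prod_encode_two[OF fin, of "\<lambda>p. (case p of (j, b) \<Rightarrow> a j * (if b = 0 then 1 - l j else l j)) * \<phi> (prod_encode p)"]
      by (simp add: J'_def a'_def algebra_simps)
    have "(\<integral>\<^sup>+x. ennreal (exp (h' x)) \<partial>PiM I M)
       \<le> ennreal (exp (\<Sum>n\<in>J'. a' n * - ln (\<integral>x. exp (- g' n x) \<partial>PiM I M)))"
    proof (rule insert.IH)
      show "a' n \<ge> 0" if "n \<in> J'" for n
        using that a \<omega>l by (auto simp: J'_def a'_def)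
      show "sum a' J' = 1"
        using sum_J'[of "\<lambda>_. 1"] a by simp
      show "g' n \<in> borel_measurable (PiM I M)" if "n \<in> J'" for n
        unfolding g'_def using g_upd w that by blast
      show "\<bar>g' n x\<bar> \<le> T" if "n \<in> J'" "x \<in> space (PiM I M)" for n x
        unfolding g'_def using T w that upd by blast
      show "h' \<in> borel_measurable (PiM I M)"
        unfolding h'_def using measurable_compose[OF upd_meas[OF \<omega>] h] by measurable
      fix x assume x: "x \<in> space (PiM I M)"
      obtain c where c: "\<And>k. k \<in> insert i I \<Longrightarrow> c k \<ge> 0"
        "\<And>y. (\<And>j. j \<in> J \<Longrightarrow> y j \<in> space (PiM (insert i I) M)) \<Longrightarrow>
          h (x(i := \<omega>)) + (\<Sum>k\<in>insert i I. (c k)\<^sup>2) \<le>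
          (\<Sum>j\<in>J. a j * (g j (y j) + (\<Sum>k\<in>insert i I. if y j k \<noteq> (x(i := \<omega>)) k then c k else 0)))"
        using cond[of "x(i := \<omega>)"] upd[OF x \<omega>] by blast
      define cost where "cost z = (\<Sum>k\<in>I. if z k \<noteq> x k then c k else 0)" for z
      have I_ne: "k \<noteq> i" if "k \<in> I" for k using that insert.hyps by auto
      have cost_upd: "(\<Sum>k\<in>insert i I. if (z(i := v)) k \<noteq> (x(i := \<omega>)) k then c k else 0) =
         (if v \<noteq> \<omega> then c i else 0) + cost z" for z v
        using insert.hyps I_ne by (auto simp: cost_def intro!: sum.cong)
      have "h' x + (\<Sum>k\<in>I. (c k)\<^sup>2) \<le> (\<Sum>n\<in>J'. a' n * (g' n (y n) + cost (y n)))"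
        if y: "\<forall>n\<in>J'. y n \<in> space (PiM I M)" for y
      proof -
        define z where "z p = (y (prod_encode p))(i := w p)" for p
        have z: "z (j, b) \<in> space (PiM (insert i I) M)" if "j \<in> J" "b \<in> {0, 1}" for j b
          unfolding z_def using that y \<omega> \<omega>l by (intro upd) (auto simp: J'_def w_def)
        define \<phi> where "\<phi> p = g (fst p) (z p) + (\<Sum>k\<in>insert i I. if z p k \<noteq> (x(i := \<omega>)) k then c k else 0)" for p
        \<comment> \<open>The condition on \<open>h\<close> admits one competitor per
          \<open>j\<close>, but now there are two. The cheaper one costs at most the convex
          combination with weights \<open>1 - l j\<close> and \<open>l j\<close>.\<close>
        define b where "b j = (if \<phi> (j, 0) \<le> \<phi> (j, 1) then 0 else 1 :: nat)" for j
        have "h (x(i := \<omega>)) + (\<Sum>k\<in>insert i I. (c k)\<^sup>2) \<le> (\<Sum>j\<in>J. a j * \<phi> (j, b j))"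
          using c(2)[of "\<lambda>j. z (j, b j)"] z by (auto simp: \<phi>_def b_def)
        also have "\<dots> \<le> (\<Sum>j\<in>J. a j * ((1 - l j) * \<phi> (j, 0) + l j * \<phi> (j, 1)))"
        proof (intro sum_mono mult_left_mono a)
          fix j assume j: "j \<in> J"
          have "(1 - l j) * \<phi> (j, b j) + l j * \<phi> (j, b j) \<le> (1 - l j) * \<phi> (j, 0) + l j * \<phi> (j, 1)"
            using \<omega>l[OF j] by (intro add_mono mult_left_mono) (auto simp: b_def)
          then show "\<phi> (j, b j) \<le> (1 - l j) * \<phi> (j, 0) + l j * \<phi> (j, 1)"
            by (simp add: algebra_simps)
        qed
        also have "\<dots> \<le> (\<Sum>j\<in>J. a j * ((1 - l j) * (g' (prod_encode (j, 0)) (y (prod_encode (j, 0))) + cost (y (prod_encode (j, 0))))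
            + l j * (g' (prod_encode (j, 1)) (y (prod_encode (j, 1))) + cost (y (prod_encode (j, 1))))
            + ((c i)\<^sup>2 + (l j)\<^sup>2 / 4)))"
        proof (intro sum_mono mult_left_mono a)
          fix j assume j: "j \<in> J"
          have 0: "\<phi> (j, 0) = g' (prod_encode (j, 0)) (y (prod_encode (j, 0))) + cost (y (prod_encode (j, 0)))"
            unfolding \<phi>_def z_def g'_def cost_upd by (simp add: w_def)
          have 1: "\<phi> (j, 1) \<le> g' (prod_encode (j, 1)) (y (prod_encode (j, 1))) + cost (y (prod_encode (j, 1))) + c i"
            unfolding \<phi>_def z_def g'_def cost_upd using c(1)[of i] by simp
          \<comment> \<open>This expands \<open>(c i - l j / 2)^2 \<ge> 0\<close>. The summand
            \<open>(c i)^2\<close> is exactly what the coordinate \<open>i\<close> adds on the side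
            of \<open>h\<close>; the other summand is the reason for the 1/4 in the scalar
            inequality.\<close>
          have "l j * c i \<le> (c i)\<^sup>2 + (l j)\<^sup>2 / 4"
            using zero_le_power2[of "c i - l j / 2"] by (simp add: power2_eq_square algebra_simps)
          moreover have "l j * \<phi> (j, 1) \<le> l j * (g' (prod_encode (j, 1)) (y (prod_encode (j, 1))) + cost (y (prod_encode (j, 1))) + c i)"
            using 1 \<omega>l[OF j] by (intro mult_left_mono) auto
          ultimately show "(1 - l j) * \<phi> (j, 0) + l j * \<phi> (j, 1) \<le> (1 - l j) * (g' (prod_encode (j, 0)) (y (prod_encode (j, 0))) + cost (y (prod_encode (j, 0))))
            + l j * (g' (prod_encode (j, 1)) (y (prod_encode (j, 1))) + cost (y (prod_encode (j, 1))))
            + ((c i)\<^sup>2 + (l j)\<^sup>2 / 4)"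
            unfolding 0 by (simp add: algebra_simps)
        qed
        also have "\<dots> = (\<Sum>n\<in>J'. a' n * (g' n (y n) + cost (y n))) + (\<Sum>j\<in>J. a j * (c i)\<^sup>2) + D"
          unfolding sum_J' D_def by (simp add: distrib_left sum.distrib)
        also have "(\<Sum>j\<in>J. a j * (c i)\<^sup>2) = (c i)\<^sup>2"
          using a by (simp flip: sum_distrib_right)
        finally show ?thesis
          using insert.hyps by (simp add: h'_def del: fun_upd_apply)
      qed
      then show "\<exists>c. (\<forall>i\<in>I. c i \<ge> 0) \<and>
       (\<forall>y. (\<forall>j\<in>J'. y j \<in> space (PiM I M)) \<longrightarrow>
          h' x + (\<Sum>i\<in>I. (c i)\<^sup>2) \<le> (\<Sum>j\<in>J'. a' j * (g' j (y j) + (\<Sum>i\<in>I. if y j i \<noteq> x i then c i else 0))))"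
        using c(1) by (intro exI[of _ c]) (auto simp: cost_def)
    qed
    also have "(\<Sum>n\<in>J'. a' n * - ln (\<integral>x. exp (- g' n x) \<partial>PiM I M)) =
        (\<Sum>j\<in>J. a j * ((1 - l j) * G j \<omega> + l j * G j (\<omega>' j)))"
      unfolding sum_J' by (simp add: g'_def G_def E_def w_def)
    finally have "ennreal (exp D) * (\<integral>\<^sup>+x. ennreal (exp (h' x)) \<partial>PiM I M) \<le>
      ennreal (exp D) * ennreal (exp (\<Sum>j\<in>J. a j * ((1 - l j) * G j \<omega> + l j * G j (\<omega>' j))))"
      by (rule mult_left_mono) simp
    also have "\<dots> = ennreal (exp (\<Sum>j\<in>J. a j * (l j * G j (\<omega>' j) + (1 - l j) * G j \<omega> + (l j)\<^sup>2 / 4)))"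
      by (simp add: D_def algebra_simps flip: ennreal_mult exp_add sum.distrib)
    also have "ennreal (exp D) * (\<integral>\<^sup>+x. ennreal (exp (h' x)) \<partial>PiM I M) =
       (\<integral>\<^sup>+x. ennreal (exp (h (x(i := \<omega>)))) \<partial>PiM I M)"
    proof (subst nn_integral_cmult[symmetric])
      show "(\<lambda>x. ennreal (exp (h' x))) \<in> borel_measurable (PiM I M)"
        unfolding h'_def using measurable_compose[OF upd_meas[OF \<omega>] h] by measurable
    qed (simp add: h'_def flip: ennreal_mult exp_add)
    finally show "(\<integral>\<^sup>+x. ennreal (exp (h (x(i := \<omega>)))) \<partial>PiM I M) \<le>
       ennreal (exp (\<Sum>j\<in>J. a j * (l j * G j (\<omega>' j) + (1 - l j) * G j \<omega> + (l j)\<^sup>2 / 4)))" .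
  qed
  also have "(\<Sum>j\<in>J. a j * - ln (\<integral>\<omega>. exp (- G j \<omega>) \<partial>M i)) =
      (\<Sum>j\<in>J. a j * - ln (\<integral>x. exp (- g j x) \<partial>PiM (insert i I) M))"
  proof (intro sum.cong refl)
    fix j assume j: "j \<in> J"
    have "(\<integral>\<omega>. exp (- G j \<omega>) \<partial>M i) = (\<integral>\<omega>. E j \<omega> \<partial>M i)"
      using E_pos[OF j] by (intro Bochner_Integration.integral_cong) (auto simp: G_def)
    also have "\<dots> = (\<integral>x. exp (- g j x) \<partial>PiM (insert i I) M)"
      unfolding E_def using g[OF j] T[OF j] insert.hyps
      by (intro integral_PiM_insert_rev[where B="exp T", symmetric] M) (auto, fastforce)
    finally show "a j * - ln (\<integral>\<omega>. exp (- G j \<omega>) \<partial>M i) = a j * - ln (\<integral>x. exp (- g j x) \<partial>PiM (insert i I) M)"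
      by simp
  qed
  finally show ?case .
qed

text \<open>The hypothesis \<open>d\<close> provides a weight vector witnessing that
  \<open>x\<close> has convex distance at least \<open>s\<close> from \<open>A\<close>. The family
  inequality is used with a single bounded \<open>g\<close>, a penalty for leaving \<open>A\<close>
  that is as large as the cost of reaching \<open>A\<close> from \<open>x\<close>. Then
  \<open>exp (- g)\<close> dominates the indicator of \<open>A\<close>, and \<open>exp h\<close>
  dominates \<open>exp (s^2 / 4)\<close> times that of \<open>B\<close>.\<close>

theorem talagrand_convex_distance:
  fixes M :: "'c \<Rightarrow> 'b measure"
  assumes M: "\<And>i. prob_space (M i)" and I: "finite I"
    and A: "A \<in> sets (PiM I M)" and B: "B \<in> sets (PiM I M)" and "s \<ge> 0"
    and d: "\<And>x. x \<in> B \<Longrightarrow> \<exists>u. (\<forall>i\<in>I. u i \<ge> 0) \<and> (\<Sum>i\<in>I. (u i)\<^sup>2) \<le> 1 \<and>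
       (\<forall>y\<in>A. s \<le> (\<Sum>i\<in>I. if y i \<noteq> x i then u i else 0))"
  shows "measure (PiM I M) A * measure (PiM I M) B \<le> exp (- (s\<^sup>2 / 4))"
proof (cases "measure (PiM I M) A = 0")
  case False
  have "prob_space (PiM I M)" by (rule prob_space_PiM) (rule M)
  then interpret prob_space "PiM I M" .
  let ?P = "PiM I M"
  define g where "g x = s\<^sup>2 / 2 * (1 - indicator A x)" for x
  define h where "h x = s\<^sup>2 / 4 * indicator B x" for x
  have g: "g \<in> borel_measurable ?P"
    unfolding g_def using A by measurable
  have *: "(\<integral>\<^sup>+x. ennreal (exp (h x)) \<partial>?P) \<le> ennreal (exp (\<Sum>j\<in>{0::nat}. 1 * - ln (\<integral>x. exp (- g x) \<partial>?P)))"
  proof (rule talagrand_family[where T="s\<^sup>2 / 2", OF M I])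
    show "h \<in> borel_measurable ?P"
      unfolding h_def using B by measurable
    fix x assume "x \<in> space ?P"
    show "\<exists>c. (\<forall>i\<in>I. c i \<ge> 0) \<and>
       (\<forall>y. (\<forall>j\<in>{0::nat}. y j \<in> space ?P) \<longrightarrow>
          h x + (\<Sum>i\<in>I. (c i)\<^sup>2) \<le> (\<Sum>j\<in>{0::nat}. 1 * (g (y j) + (\<Sum>i\<in>I. if y j i \<noteq> x i then c i else 0))))"
    proof (cases "x \<in> B")
      case True
      from d[OF this] obtain u where u: "\<And>i. i \<in> I \<Longrightarrow> u i \<ge> 0" "(\<Sum>i\<in>I. (u i)\<^sup>2) \<le> 1"
        "\<And>y. y \<in> A \<Longrightarrow> s \<le> (\<Sum>i\<in>I. if y i \<noteq> x i then u i else 0)" by auto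
      \<comment> \<open>With weights \<open>t * u\<close> the cost of reaching \<open>A\<close> is
        at least \<open>t * s\<close> and the quadratic term is at most \<open>t^2\<close>. The
        difference \<open>t * s - t^2\<close> is largest at \<open>t = s / 2\<close>, where it
        equals \<open>s^2 / 4\<close>.\<close>
      have "(\<Sum>i\<in>I. (s / 2 * u i)\<^sup>2) = s\<^sup>2 / 4 * (\<Sum>i\<in>I. (u i)\<^sup>2)"
        by (simp add: power_mult_distrib sum_distrib_left power_divide)
      also have "\<dots> \<le> s\<^sup>2 / 4 * 1"
        using u by (intro mult_left_mono) auto
      finally have 1: "h x + (\<Sum>i\<in>I. (s / 2 * u i)\<^sup>2) \<le> s\<^sup>2 / 2"
        using True by (simp add: h_def)
      have 2: "s\<^sup>2 / 2 \<le> g y + (\<Sum>i\<in>I. if y i \<noteq> x i then s / 2 * u i else 0)" for y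
      proof (cases "y \<in> A")
        case True
        have "s\<^sup>2 / 2 = s / 2 * s" by (simp add: power2_eq_square)
        also have "\<dots> \<le> s / 2 * (\<Sum>i\<in>I. if y i \<noteq> x i then u i else 0)"
          using u(3)[OF True] \<open>s \<ge> 0\<close> by (intro mult_left_mono) auto
        also have "\<dots> = (\<Sum>i\<in>I. if y i \<noteq> x i then s / 2 * u i else 0)"
          by (auto simp: sum_distrib_left intro!: sum.cong)
        finally show ?thesis using True by (simp add: g_def)
      next
        case False
        then show ?thesis using u(1) \<open>s \<ge> 0\<close> by (auto simp: g_def intro!: sum_nonneg)
      qed
      show ?thesis
        using order_trans[OF 1 2] u(1) \<open>s \<ge> 0\<close> by (intro exI[of _ "\<lambda>i. s / 2 * u i"]) auto
    next
      case False
      then show ?thesis by (intro exI[of _ "\<lambda>_. 0"]) (auto simp: h_def g_def)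
    qed
  qed (auto simp: g, auto simp: g_def split: split_indicator)
  have "(\<integral>x. exp (- g x) \<partial>?P) \<ge> prob A"
  proof -
    have "prob A = (\<integral>x. indicator A x \<partial>?P)" using A by simp
    also have "\<dots> \<le> (\<integral>x. exp (- g x) \<partial>?P)"
    proof (rule integral_mono)
      show "integrable ?P (\<lambda>x. exp (- g x))"
      proof (rule integrable_const_bound[where B=1])
        show "(\<lambda>x. exp (- g x)) \<in> borel_measurable ?P" using g by measurable
      qed (auto simp: g_def split: split_indicator)
    qed (use A in \<open>auto simp: g_def emeasure_eq_measure intro!: integrable_real_indicator
        split: split_indicator\<close>)
    finally show ?thesis .
  qed
  moreover have pos: "prob A > 0" using False by (simp add: zero_less_measure_iff)
  ultimately have "exp (- ln (\<integral>x. exp (- g x) \<partial>?P)) \<le> 1 / prob A"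
    by (simp add: exp_minus frac_le inverse_eq_divide)
  then have le: "(\<integral>\<^sup>+x. ennreal (exp (h x)) \<partial>?P) \<le> ennreal (1 / prob A)"
    using * by (auto intro: order_trans ennreal_leI)
  have "ennreal (exp (s\<^sup>2 / 4) * prob B) = (\<integral>\<^sup>+x. ennreal (exp (s\<^sup>2 / 4)) * indicator B x \<partial>?P)"
    using B by (subst nn_integral_cmult_indicator) (auto simp: emeasure_eq_measure ennreal_mult)
  also have "\<dots> \<le> (\<integral>\<^sup>+x. ennreal (exp (h x)) \<partial>?P)"
    by (intro nn_integral_mono) (auto simp: h_def split: split_indicator)
  finally have "ennreal (exp (s\<^sup>2 / 4) * prob B) \<le> ennreal (1 / prob A)"
    using le by (rule order_trans)
  then have "exp (s\<^sup>2 / 4) * prob B \<le> 1 / prob A"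
    by (subst (asm) ennreal_le_iff) auto
  then show ?thesis
    using pos by (simp add: exp_minus field_simps)
qed simp

section \<open>Measurability of sums over configurations\<close>

lemma countable_loc_finite: "\<xi> \<in> loc_finite_sets \<Longrightarrow> countable \<xi>"
proof -
  assume "\<xi> \<in> loc_finite_sets"
  then have "finite (\<xi> \<inter> ball 0 (real n))" for n
    by (auto simp: loc_finite_sets_def)
  then have "countable (\<Union>n::nat. \<xi> \<inter> ball 0 (real n))"
    by (intro countable_UN) (auto intro: countable_finite)
  also have "(\<Union>n::nat. \<xi> \<inter> ball 0 (real n)) = \<xi>"
    using reals_Archimedean2 by (auto simp: dist_norm)
  finally show ?thesis .
qed

lemma loc_finite_Int: "\<xi> \<in> loc_finite_sets \<Longrightarrow> \<xi> \<inter> A \<in> loc_finite_sets"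
  by (auto simp: loc_finite_sets_def Int_assoc intro: finite_subset[of "\<xi> \<inter> A \<inter> B" "\<xi> \<inter> B" for B])

lemma space_config_space: "space config_space = (loc_finite_sets :: 'a::euclidean_space set set)"
  unfolding config_space_def by (subst space_Sup_eq_UN) auto

lemma measurable_pts_in [measurable]:
  "A \<in> sets borel \<Longrightarrow> (\<lambda>\<xi>. pts_in \<xi> A) \<in> borel_measurable config_space"
  unfolding config_space_def
  by (rule measurable_SUP1[where i=A]) (auto intro: measurable_vimage_algebra1)

lemma measurable_config_spaceI:
  assumes "\<And>x. x \<in> space N \<Longrightarrow> S x \<in> loc_finite_sets"
    and "\<And>A. A \<in> sets borel \<Longrightarrow> (\<lambda>x. pts_in (S x) A) \<in> borel_measurable N"
  shows "S \<in> measurable N config_space"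
  unfolding config_space_def
  by (rule measurable_SUP2) (use assms in \<open>auto intro!: measurable_vimage_algebra2\<close>)

lemma pts_in_Int: "pts_in (\<xi> \<inter> B) A = pts_in \<xi> (B \<inter> A)"
  by (simp add: pts_in_def Int_assoc)

lemma measurable_Int_config_space [measurable]:
  "B \<in> sets borel \<Longrightarrow> (\<lambda>\<xi>. \<xi> \<inter> B) \<in> measurable config_space config_space"
  by (rule measurable_config_spaceI) (auto simp: space_config_space pts_in_Int intro: loc_finite_Int)

text \<open>U-statistics are defined by unordered sums, whereas measurability in the configuration
  is proved for integrals against counting measure. Countability supplies an increasing sequence of
  finite sets exhausting \<open>A\<close>, to which monotone convergence applies.\<close>

lemma infsum_ennreal_eq_nn_integral:
  fixes f :: "'b \<Rightarrow> ennreal"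
  assumes "countable A"
  shows "(\<Sum>\<^sub>\<infinity>x\<in>A. f x) = (\<integral>\<^sup>+x. f x \<partial>count_space A)"
proof (rule antisym)
  have eq: "(\<Sum>\<^sub>\<infinity>x\<in>A. f x) = (SUP F\<in>{F. finite F \<and> F \<subseteq> A}. sum f F)"
    by (rule nonneg_infsum_complete) auto
  have sum_eq: "sum f F = (\<integral>\<^sup>+x. f x * indicator F x \<partial>count_space A)" if "finite F" "F \<subseteq> A" for F
  proof -
    have "(\<integral>\<^sup>+x. f x * indicator F x \<partial>count_space A) = (\<Sum>x\<in>F. f x * indicator F x)"
      using that by (intro nn_integral_count_space') auto
    then show ?thesis by simp
  qed
  show "(\<Sum>\<^sub>\<infinity>x\<in>A. f x) \<le> (\<integral>\<^sup>+x. f x \<partial>count_space A)"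
    unfolding eq
  proof (rule SUP_least, safe)
    fix F assume F: "finite F" "F \<subseteq> A"
    show "sum f F \<le> (\<integral>\<^sup>+x. f x \<partial>count_space A)"
      unfolding sum_eq[OF F] by (intro nn_integral_mono) (auto split: split_indicator)
  qed
  show "(\<integral>\<^sup>+x. f x \<partial>count_space A) \<le> (\<Sum>\<^sub>\<infinity>x\<in>A. f x)"
  proof (cases "A = {}")
    case False
    define F where "F n = from_nat_into A ` {..<n}" for n :: nat
    have F: "finite (F n)" "F n \<subseteq> A" for n
      using from_nat_into[OF False] by (auto simp: F_def)
    have mono: "incseq F" by (auto simp: incseq_def F_def)
    have ev: "\<exists>n. x \<in> F n" if "x \<in> A" for x
      using from_nat_into_surj[OF assms that] by (force simp: F_def)
    have f_eq: "f x = (SUP n. f x * indicator (F n) x)" if "x \<in> A" for x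
    proof (rule antisym)
      from ev[OF that] obtain n where "x \<in> F n" ..
      then show "f x \<le> (SUP n. f x * indicator (F n) x)"
        by (intro SUP_upper2[of n]) auto
      show "(SUP n. f x * indicator (F n) x) \<le> f x"
        by (intro SUP_least) (auto split: split_indicator)
    qed
    have "(\<integral>\<^sup>+x. f x \<partial>count_space A) = (\<integral>\<^sup>+x. (SUP n. f x * indicator (F n) x) \<partial>count_space A)"
      using f_eq by (intro nn_integral_cong) auto
    also have "\<dots> = (SUP n. (\<integral>\<^sup>+x. f x * indicator (F n) x \<partial>count_space A))"
      using mono by (intro nn_integral_monotone_convergence_SUP)
        (auto simp: incseq_def le_fun_def split: split_indicator)
    also have "\<dots> \<le> (\<Sum>\<^sub>\<infinity>x\<in>A. f x)"
      unfolding eq using F by (intro SUP_mono) (auto simp flip: sum_eq)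
    finally show ?thesis .
  qed (simp add: nn_integral_count_space_finite)
qed

text \<open>Counting measure on \<open>S m\<close> is a transition kernel in \<open>m\<close>: on
  rectangles its value is an indicator times a counting map, a Dynkin argument extends this to all
  measurable sets of the product, and monotone approximation to all \<open>g\<close>.\<close>

lemma measurable_nn_integral_config:
  fixes g :: "'m \<times> 'a::euclidean_space \<Rightarrow> ennreal"
  assumes S: "S \<in> measurable M config_space" and g: "g \<in> borel_measurable (M \<Otimes>\<^sub>M borel)"
  shows "(\<lambda>m. \<integral>\<^sup>+x. g (m, x) \<partial>count_space (S m)) \<in> borel_measurable M"
proof -
  have S_lf: "S m \<in> loc_finite_sets" if "m \<in> space M" for m
    using measurable_space[OF S that] by (simp add: space_config_space)
  have S_pts: "(\<lambda>m. pts_in (S m) A) \<in> borel_measurable M" if "A \<in> sets borel" for A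
    using measurable_compose[OF S measurable_pts_in[OF that]] .
  \<comment> \<open>The ball makes all counts finite, so complements can be treated by subtraction
    in \<open>ennreal\<close>; a supremum over \<open>n\<close> removes it again.\<close>
  define K where "K n D m = emeasure (count_space UNIV) (S m \<inter> (ball 0 (real n) \<inter> Pair m -` D))"
    for n :: nat and D :: "('m \<times> 'a) set" and m
  have K: "K n D \<in> borel_measurable M" if "D \<in> sets (M \<Otimes>\<^sub>M borel)" for D n
    using Int_stable_pair_measure_generator[of M borel] pair_measure_closed[of M borel] that[unfolded sets_pair_measure]
  proof (induction D rule: sigma_sets_induct_disjoint)
    case (basic D)
    then obtain A B where D: "D = A \<times> B" and A: "A \<in> sets M" and B: "B \<in> sets borel" by auto
    have "K n D m = indicator A m * pts_in (S m) (ball 0 (real n) \<inter> B)" for m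
      by (auto simp: K_def D pts_in_def split: split_indicator)
    then show ?case using A B S_pts by (subst measurable_cong) auto
  next
    case empty
    then show ?case by (simp add: K_def)
  next
    case (compl D)
    have "K n (space M \<times> space borel - D) m = pts_in (S m) (ball 0 (real n)) - K n D m"
      if "m \<in> space M" for m
    proof -
      have "S m \<inter> (ball 0 (real n) \<inter> Pair m -` (space M \<times> space borel - D)) =
          S m \<inter> ball 0 (real n) - S m \<inter> (ball 0 (real n) \<inter> Pair m -` D)"
        using that by auto
      moreover have "finite (S m \<inter> ball 0 (real n))"
        using S_lf[OF that] by (auto simp: loc_finite_sets_def)
      then have "emeasure (count_space UNIV) (S m \<inter> (ball 0 (real n) \<inter> Pair m -` D)) \<noteq> \<infinity>"
        by (intro emeasure_count_space_finite[THEN ord_eq_less_trans, THEN less_imp_neq])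
          (auto intro: finite_subset simp: of_nat_less_top)
      ultimately show ?thesis
        unfolding K_def pts_in_def by (subst emeasure_Diff[symmetric]) auto
    qed
    moreover have "(\<lambda>m. pts_in (S m) (ball 0 (real n)) - K n D m) \<in> borel_measurable M"
      using compl.IH S_pts[of "ball 0 (real n)"] by measurable
    ultimately show ?case by (rule measurable_cong[THEN iffD2])
  next
    case (union D)
    have "K n (\<Union>i. D i) m = (\<Sum>i. K n (D i) m)" for m
    proof -
      have "S m \<inter> (ball 0 (real n) \<inter> Pair m -` (\<Union>i. D i)) =
          (\<Union>i. S m \<inter> (ball 0 (real n) \<inter> Pair m -` D i))" by auto
      then show ?thesis
        unfolding K_def using union(1)
        by (subst suminf_emeasure) (auto simp: disjoint_family_on_def)
    qed
    then have "K n (\<Union>i. D i) = (\<lambda>m. \<Sum>i. K n (D i) m)" by auto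
    then show ?case using union.IH by simp
  qed
  show ?thesis
    using g
  proof (induction g rule: borel_measurable_induct)
    case (cong f g)
    then have "(\<integral>\<^sup>+x. f (m, x) \<partial>count_space (S m)) = (\<integral>\<^sup>+x. g (m, x) \<partial>count_space (S m))"
      if "m \<in> space M" for m
      using that by (intro nn_integral_cong) (auto simp: space_pair_measure)
    then show ?case using cong(4) by (subst measurable_cong) auto
  next
    case (set D)
    have "(\<integral>\<^sup>+x. indicator D (m, x) \<partial>count_space (S m)) = (SUP n. K n D m)" for m
    proof -
      have "(\<integral>\<^sup>+x. indicator D (m, x) \<partial>count_space (S m)) =
          emeasure (count_space UNIV) (S m \<inter> Pair m -` D)"
      proof -
        have "(\<integral>\<^sup>+x. indicator D (m, x) \<partial>count_space (S m)) =
            (\<integral>\<^sup>+x. indicator (S m \<inter> Pair m -` D) x \<partial>count_space UNIV)"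
          by (subst nn_integral_count_space_indicator, simp, intro nn_integral_cong)
            (auto split: split_indicator)
        then show ?thesis by simp
      qed
      also have "S m \<inter> Pair m -` D = (\<Union>n. S m \<inter> (ball 0 (real n) \<inter> Pair m -` D))"
        using reals_Archimedean2 by auto
      also have "emeasure (count_space UNIV) \<dots> = (SUP n. K n D m)"
        unfolding K_def by (subst SUP_emeasure_incseq) (auto simp: incseq_def)
      finally show ?thesis .
    qed
    then show ?case using K[OF set] by simp
  next
    case (mult u c)
    then show ?case by (simp add: nn_integral_cmult)
  next
    case (add u v)
    then show ?case by (simp add: nn_integral_add)
  next
    case (seq U)
    have "(\<integral>\<^sup>+x. (SUP i. U i) (m, x) \<partial>count_space (S m)) = (SUP i. \<integral>\<^sup>+x. U i (m, x) \<partial>count_space (S m))" for m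
      using seq(3) unfolding SUP_apply
      by (intro nn_integral_monotone_convergence_SUP) (auto simp: incseq_def le_fun_def)
    then show ?case using seq by simp
  qed
qed

section \<open>Sums over tuples of points\<close>

lemma nn_integral_count_space_PiE_Suc:
  assumes "countable A"
  shows "(\<integral>\<^sup>+z. h z \<partial>count_space ({..<Suc k} \<rightarrow>\<^sub>E A)) =
    (\<integral>\<^sup>+y. \<integral>\<^sup>+x. h (y(k := x)) \<partial>count_space A \<partial>count_space ({..<k} \<rightarrow>\<^sub>E A))"
proof -
  let ?B = "{..<k} \<rightarrow>\<^sub>E A"
  have B: "countable ?B" using assms by (intro countable_PiE) auto
  have "bij_betw (\<lambda>(y, x). y(k := x)) (?B \<times> A) ({..<Suc k} \<rightarrow>\<^sub>E A)"
  proof (rule bij_betw_byWitness[where f'="\<lambda>z. (restrict z {..<k}, z k)"])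
    have "restrict (y(k := x)) {..<k} = y" if "y \<in> ?B" for y x
    proof
      show "restrict (y(k := x)) {..<k} i = y i" for i
        using PiE_arb[OF that, of i] by (cases "i < k") auto
    qed
    then show "\<forall>p\<in>?B \<times> A. (restrict (case p of (y, x) \<Rightarrow> y(k := x)) {..<k}, (case p of (y, x) \<Rightarrow> y(k := x)) k) = p"
      by (auto simp del: fun_upd_apply simp: fun_upd_same)
    have "(restrict z {..<k})(k := z k) = z" if "z \<in> {..<Suc k} \<rightarrow>\<^sub>E A" for z
    proof
      show "((restrict z {..<k})(k := z k)) i = z i" for i
        using PiE_arb[OF that, of i] by (cases "i < k"; cases "i = k") auto
    qed
    then show "\<forall>z\<in>{..<Suc k} \<rightarrow>\<^sub>E A. (case (restrict z {..<k}, z k) of (y, x) \<Rightarrow> y(k := x)) = z"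
      by (simp del: fun_upd_apply)
    show "(\<lambda>(y, x). y(k := x)) ` (?B \<times> A) \<subseteq> {..<Suc k} \<rightarrow>\<^sub>E A"
      unfolding lessThan_Suc by (auto simp del: fun_upd_apply intro!: PiE_fun_upd)
    show "(\<lambda>z. (restrict z {..<k}, z k)) ` ({..<Suc k} \<rightarrow>\<^sub>E A) \<subseteq> ?B \<times> A"
    proof (intro image_subsetI SigmaI)
      fix z assume z: "z \<in> {..<Suc k} \<rightarrow>\<^sub>E A"
      show "restrict z {..<k} \<in> ?B" using PiE_mem[OF z] by simp
      show "z k \<in> A" by (rule PiE_mem[OF z]) simp
    qed
  qed
  then have "(\<integral>\<^sup>+z. h z \<partial>count_space ({..<Suc k} \<rightarrow>\<^sub>E A)) =
     (\<integral>\<^sup>+p. h (case p of (y, x) \<Rightarrow> y(k := x)) \<partial>count_space (?B \<times> A))"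
    by (intro nn_integral_bij_count_space[symmetric])
  also have "\<dots> = (\<integral>\<^sup>+p. h (case p of (y, x) \<Rightarrow> y(k := x)) \<partial>(count_space ?B \<Otimes>\<^sub>M count_space A))"
    using assms B by (simp add: pair_measure_countable)
  also have "\<dots> = (\<integral>\<^sup>+y. \<integral>\<^sup>+x. h (y(k := x)) \<partial>count_space A \<partial>count_space ?B)"
    using assms B
    by (subst sigma_finite_measure.nn_integral_fst[symmetric])
      (auto simp: sigma_finite_measure_count_space_countable pair_measure_countable)
  finally show ?thesis .
qed

text \<open>The last coordinate is summed out first, by the one-point result over the enlarged
  parameter space of pairs \<open>(m, y)\<close>. This is why that result allows an arbitrary
  parameter space and not only the space of configurations.\<close>

lemma measurable_nn_integral_tuples:
  fixes g :: "'m \<times> (nat \<Rightarrow> 'a::euclidean_space) \<Rightarrow> ennreal"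
  assumes S: "S \<in> measurable M config_space"
    and g: "g \<in> borel_measurable (M \<Otimes>\<^sub>M PiM {..<k} (\<lambda>_. borel))"
  shows "(\<lambda>m. \<integral>\<^sup>+y. g (m, y) \<partial>count_space ({..<k} \<rightarrow>\<^sub>E S m)) \<in> borel_measurable M"
  using g
proof (induction k arbitrary: g)
  case 0
  have "(\<lambda>m. g (m, \<lambda>_. undefined)) \<in> borel_measurable M"
    by (rule measurable_compose[OF measurable_Pair2' 0]) (simp add: space_PiM)
  then show ?case by (simp add: nn_integral_count_space_finite)
next
  case (Suc k)
  have S_lf: "S m \<in> loc_finite_sets" if "m \<in> space M" for m
    using measurable_space[OF S that] by (simp add: space_config_space)
  let ?P = "PiM {..<k} (\<lambda>_. borel :: 'a measure)"
  have upd: "(\<lambda>p. (fst (fst p), (snd (fst p))(k := snd p))) \<in>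
     measurable ((M \<Otimes>\<^sub>M ?P) \<Otimes>\<^sub>M borel) (M \<Otimes>\<^sub>M PiM {..<Suc k} (\<lambda>_. borel))"
  proof (rule measurable_Pair)
    have "(\<lambda>p. (\<lambda>(f, y). f(k := y)) (snd (fst p), snd p)) \<in>
        measurable ((M \<Otimes>\<^sub>M ?P) \<Otimes>\<^sub>M borel) (PiM (insert k {..<k}) (\<lambda>_. borel))"
      by (rule measurable_compose[OF _ measurable_add_dim]) measurable
    then show "(\<lambda>p. (snd (fst p))(k := snd p)) \<in>
        measurable ((M \<Otimes>\<^sub>M ?P) \<Otimes>\<^sub>M borel) (PiM {..<Suc k} (\<lambda>_. borel))"
      by (simp add: lessThan_Suc)
  qed measurable
  have "(\<lambda>q. \<integral>\<^sup>+x. g (fst q, (snd q)(k := x)) \<partial>count_space (S (fst q))) \<in> borel_measurable (M \<Otimes>\<^sub>M ?P)"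
    using measurable_nn_integral_config[OF measurable_compose[OF measurable_fst S] measurable_compose[OF upd Suc.prems]]
    by simp
  from Suc.IH[OF this]
  have "(\<lambda>m. \<integral>\<^sup>+y. \<integral>\<^sup>+x. g (m, y(k := x)) \<partial>count_space (S m) \<partial>count_space ({..<k} \<rightarrow>\<^sub>E S m)) \<in> borel_measurable M"
    by simp
  then show ?case
    by (rule measurable_cong[THEN iffD1, rotated])
      (simp add: nn_integral_count_space_PiE_Suc countable_loc_finite S_lf)
qed

section \<open>U-statistics and their local versions\<close>

definition local_sq :: "nat \<Rightarrow> ((nat \<Rightarrow> 'a) \<Rightarrow> real) \<Rightarrow> 'a set \<Rightarrow> ennreal" where
  "local_sq k f \<xi> = (\<Sum>\<^sub>\<infinity>x\<in>\<xi>. (U_stat_local k f x \<xi>)\<^sup>2)"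

lemma countable_distinct_tuples: "countable \<xi> \<Longrightarrow> countable (distinct_tuples k \<xi>)"
  unfolding distinct_tuples_def
  by (rule countable_subset[of _ "{..<k} \<rightarrow>\<^sub>E \<xi>"]) (auto intro: countable_PiE simp del: PiE_iff)

lemma finite_distinct_tuples: "finite \<xi> \<Longrightarrow> finite (distinct_tuples k \<xi>)"
  unfolding distinct_tuples_def
  by (rule finite_subset[of _ "{..<k} \<rightarrow>\<^sub>E \<xi>"]) (auto intro: finite_PiE simp del: PiE_iff)

lemma distinct_tuples_mono: "\<xi> \<subseteq> \<zeta> \<Longrightarrow> distinct_tuples k \<xi> \<subseteq> distinct_tuples k \<zeta>"
  unfolding distinct_tuples_def using PiE_mono[of "{..<k}" "\<lambda>_. \<xi>" "\<lambda>_. \<zeta>"] by blast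

lemma case_nat_in_PiE:
  assumes "k \<ge> 1" "y \<in> {..<k - 1} \<rightarrow>\<^sub>E A"
  shows "case_nat x y \<in> {..<k} \<rightarrow>\<^sub>E insert x A"
proof (rule PiE_I)
  fix i
  show "case_nat x y i \<in> insert x A" if "i \<in> {..<k}"
    using that PiE_mem[OF assms(2), of "i - 1"] by (cases i) auto
  show "case_nat x y i = undefined" if "i \<notin> {..<k}"
    using that PiE_arb[OF assms(2), of "i - 1"] assms(1) by (cases i) auto
qed

lemma inj_on_case_nat:
  assumes "k \<ge> 1"
  shows "inj_on (case_nat x y) {..<k} \<longleftrightarrow> inj_on y {..<k - 1} \<and> x \<notin> y ` {..<k - 1}"
proof -
  have "{..<k} = insert 0 (Suc ` {..<k - 1})"
    using assms by (metis Suc_pred' lessThan_Suc_eq_insert_0 less_eq_Suc_le One_nat_def)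
  then show ?thesis
    by (auto simp: inj_on_def)
qed

text \<open>Removes \<open>x\<close> from the index set: tuples range over the fixed
  \<open>\<xi>\<close>, and the exclusion of \<open>x\<close> becomes an indicator in the integrand,
  which is jointly measurable in \<open>x\<close> and \<open>y\<close>.\<close>

lemma distinct_tuples_local:
  assumes "k \<ge> 1"
  shows "distinct_tuples (k - 1) (\<xi> - {x}) = {y \<in> {..<k - 1} \<rightarrow>\<^sub>E \<xi>. inj_on (case_nat x y) {..<k}}"
  unfolding distinct_tuples_def inj_on_case_nat[OF assms] by (auto simp: PiE_iff)

lemma nn_integral_count_space_Collect:
  "(\<integral>\<^sup>+x. f x \<partial>count_space {x \<in> A. Q x}) = (\<integral>\<^sup>+x. f x * indicator {x. Q x} x \<partial>count_space A)"
  by (subst (1 2) nn_integral_count_space_indicator, simp, simp, intro nn_integral_cong)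
    (auto split: split_indicator)

lemma sets_inj_on_PiM:
  fixes k :: nat
  shows "{x \<in> space (PiM {..<k} (\<lambda>_. borel :: 'a::euclidean_space measure)). inj_on x {..<k}} \<in> sets (PiM {..<k} (\<lambda>_. borel))"
proof -
  let ?P = "PiM {..<k} (\<lambda>_. borel :: 'a measure)"
  have "(\<lambda>x. x i - x j) -` {0} \<inter> space ?P \<in> sets ?P" if "i \<in> {..<k}" "j \<in> {..<k}" for i j
    using that by (intro measurable_sets[of _ _ borel] borel_measurable_diff measurable_component_singleton) auto
  then have "space ?P - (\<Union>i\<in>{..<k}. \<Union>j\<in>{..<k} - {i}. (\<lambda>x. x i - x j) -` {0} \<inter> space ?P) \<in> sets ?P"
    by (intro sets.compl_sets sets.finite_UN) auto
  also have "space ?P - (\<Union>i\<in>{..<k}. \<Union>j\<in>{..<k} - {i}. (\<lambda>x. x i - x j) -` {0} \<inter> space ?P) =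
      {x \<in> space ?P. inj_on x {..<k}}"
    unfolding inj_on_def by auto blast
  finally show ?thesis .
qed

lemma measurable_kernel_inj:
  fixes f :: "(nat \<Rightarrow> 'a::euclidean_space) \<Rightarrow> real"
  assumes "f \<in> borel_measurable (PiM {..<k} (\<lambda>_. borel))"
  shows "(\<lambda>x. ennreal (f x) * indicator {x. inj_on x {..<k}} x) \<in> borel_measurable (PiM {..<k} (\<lambda>_. borel))"
  using assms sets_inj_on_PiM[of k]
  by (intro borel_measurable_times_ennreal borel_measurable_indicator') (auto simp: Int_def conj_commute)

lemma measurable_U_stat:
  fixes f :: "(nat \<Rightarrow> 'a::euclidean_space) \<Rightarrow> real"
  assumes f: "f \<in> borel_measurable (PiM {..<k} (\<lambda>_. borel))"
  shows "U_stat k f \<in> borel_measurable config_space"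
proof -
  have "(\<lambda>\<xi>. \<integral>\<^sup>+x. ennreal (f (snd (\<xi>, x))) * indicator {x. inj_on x {..<k}} (snd (\<xi>, x)) \<partial>count_space ({..<k} \<rightarrow>\<^sub>E \<xi>))
      \<in> borel_measurable config_space"
    by (rule measurable_nn_integral_tuples[OF measurable_ident_sets[OF refl]
          measurable_compose[OF measurable_snd measurable_kernel_inj[OF f]]])
  then show ?thesis
    by (rule measurable_cong[THEN iffD1, rotated])
      (simp add: U_stat_def infsum_ennreal_eq_nn_integral countable_distinct_tuples countable_loc_finite
        space_config_space, simp add: distinct_tuples_def nn_integral_count_space_Collect)
qed

lemma measurable_case_nat_PiM:
  assumes "k \<ge> 1"
  shows "(\<lambda>p. case_nat (fst p) (snd p)) \<in>
     measurable (borel \<Otimes>\<^sub>M PiM {..<k - 1} (\<lambda>_. borel)) (PiM {..<k} (\<lambda>_. borel :: 'a::euclidean_space measure))"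
proof (rule measurable_PiM_single')
  show "(\<lambda>p. case_nat (fst p) (snd p) i) \<in> borel_measurable (borel \<Otimes>\<^sub>M PiM {..<k - 1} (\<lambda>_. borel :: 'a measure))"
    if "i \<in> {..<k}" for i
  proof (cases i)
    case (Suc j)
    then have j: "j \<in> {..<k - 1}" using that by auto
    show ?thesis unfolding Suc nat.case
      by (rule measurable_compose[OF measurable_snd measurable_component_singleton[OF j]])
  qed simp
  show "(\<lambda>p. case_nat (fst p) (snd p)) \<in> space (borel \<Otimes>\<^sub>M PiM {..<k - 1} (\<lambda>_. borel)) \<rightarrow>
      ({..<k} \<rightarrow>\<^sub>E space (borel :: 'a measure))"
  proof
    fix p :: "'a \<times> (nat \<Rightarrow> 'a)"
    assume "p \<in> space (borel \<Otimes>\<^sub>M PiM {..<k - 1} (\<lambda>_. borel :: 'a measure))"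
    then have "snd p \<in> {..<k - 1} \<rightarrow>\<^sub>E UNIV"
      by (simp add: space_pair_measure space_PiM mem_Times_iff)
    from case_nat_in_PiE[OF assms this, of "fst p"]
    show "case_nat (fst p) (snd p) \<in> {..<k} \<rightarrow>\<^sub>E space (borel :: 'a measure)" by simp
  qed
qed

lemma measurable_local_sq:
  fixes f :: "(nat \<Rightarrow> 'a::euclidean_space) \<Rightarrow> real"
  assumes f: "f \<in> borel_measurable (PiM {..<k} (\<lambda>_. borel))" and k: "k \<ge> 1"
  shows "local_sq k f \<in> borel_measurable config_space"
proof -
  let ?h = "\<lambda>x. ennreal (f x) * indicator {x. inj_on x {..<k}} x"
  let ?C = "config_space :: 'a set measure"
  let ?N = "(?C \<Otimes>\<^sub>M borel) \<Otimes>\<^sub>M PiM {..<k - 1} (\<lambda>_. borel :: 'a measure)"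
  have "(\<lambda>q. (\<lambda>p. case_nat (fst p) (snd p)) (snd (fst q), snd q)) \<in> measurable ?N (PiM {..<k} (\<lambda>_. borel))"
    by (rule measurable_compose[OF _ measurable_case_nat_PiM[OF k]]) measurable
  from measurable_compose[OF this measurable_kernel_inj[OF f]]
  have "(\<lambda>q. ?h (case_nat (snd (fst q)) (snd q))) \<in> borel_measurable ?N"
    by simp
  from measurable_nn_integral_tuples[OF measurable_fst this]
  have "(\<lambda>p. \<integral>\<^sup>+y. ?h (case_nat (snd p) y) \<partial>count_space ({..<k - 1} \<rightarrow>\<^sub>E fst p)) \<in> borel_measurable (?C \<Otimes>\<^sub>M borel)"
    by simp
  then have "(\<lambda>p. (\<integral>\<^sup>+y. ?h (case_nat (snd p) y) \<partial>count_space ({..<k - 1} \<rightarrow>\<^sub>E fst p))\<^sup>2) \<in> borel_measurable (?C \<Otimes>\<^sub>M borel)"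
    by measurable
  from measurable_nn_integral_config[OF measurable_ident_sets[OF refl] this]
  have "(\<lambda>\<xi>. \<integral>\<^sup>+x. (\<integral>\<^sup>+y. ?h (case_nat x y) \<partial>count_space ({..<k - 1} \<rightarrow>\<^sub>E \<xi>))\<^sup>2 \<partial>count_space \<xi>) \<in> borel_measurable ?C"
    by simp
  then show ?thesis
  proof (rule measurable_cong[THEN iffD1, rotated])
    fix \<xi> :: "'a set" assume "\<xi> \<in> space config_space"
    then have \<xi>: "countable \<xi>" by (simp add: space_config_space countable_loc_finite)
    have "U_stat_local k f x \<xi> = (\<integral>\<^sup>+y. ?h (case_nat x y) \<partial>count_space ({..<k - 1} \<rightarrow>\<^sub>E \<xi>))" for x
    proof -
      have "countable (distinct_tuples (k - 1) (\<xi> - {x}))"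
        using \<xi> by (intro countable_distinct_tuples) auto
      then have "U_stat_local k f x \<xi> = (\<integral>\<^sup>+y. ennreal (f (case_nat x y)) \<partial>count_space (distinct_tuples (k - 1) (\<xi> - {x})))"
        unfolding U_stat_local_def by (rule infsum_ennreal_eq_nn_integral)
      then show ?thesis
        unfolding distinct_tuples_local[OF k] nn_integral_count_space_Collect by (simp add: indicator_def)
    qed
    then show "(\<integral>\<^sup>+x. (\<integral>\<^sup>+y. ?h (case_nat x y) \<partial>count_space ({..<k - 1} \<rightarrow>\<^sub>E \<xi>))\<^sup>2 \<partial>count_space \<xi>) = local_sq k f \<xi>"
      using \<xi> by (simp add: local_sq_def infsum_ennreal_eq_nn_integral)
  qed
qed

text \<open>Transposing 0 and \<open>j\<close> carries the tuples with \<open>z\<close> at position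
  \<open>j\<close> to those with \<open>z\<close> in front and preserves \<open>f\<close> by
  symmetry; deleting the head gives the local version. So all positions of \<open>z\<close> yield
  the same sum.\<close>

lemma sum_distinct_tuples_coord:
  fixes f :: "(nat \<Rightarrow> 'a::euclidean_space) \<Rightarrow> real"
  assumes f: "sym_kernel k f" and "j < k" "z \<in> \<xi>"
  shows "(\<Sum>x\<in>{x \<in> distinct_tuples k \<xi>. x j = z}. f x) =
    (\<Sum>y\<in>distinct_tuples (k - 1) (\<xi> - {z}). f (case_nat z y))"
proof -
  have k: "k \<ge> 1" using assms by simp
  let ?t = "Transposition.transpose 0 j"
  have t: "?t permutes {..<k}" using assms by (intro permutes_swap_id) auto
  have t_in: "x \<circ> ?t \<in> distinct_tuples k \<xi>" if "x \<in> distinct_tuples k \<xi>" for x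
  proof -
    have x: "x \<in> {..<k} \<rightarrow>\<^sub>E \<xi>" "inj_on x {..<k}" using that by (auto simp: distinct_tuples_def)
    have "inj_on (x \<circ> ?t) {..<k}"
      using x t by (intro comp_inj_on) (auto simp: permutes_image intro: permutes_inj_on)
    moreover have "x \<circ> ?t \<in> {..<k} \<rightarrow>\<^sub>E \<xi>"
    proof (rule PiE_I)
      fix i
      show "(x \<circ> ?t) i \<in> \<xi>" if "i \<in> {..<k}"
        using PiE_mem[OF x(1), of "?t i"] permutes_in_image[OF t] that by simp
      show "(x \<circ> ?t) i = undefined" if "i \<notin> {..<k}"
        using PiE_arb[OF x(1), of "?t i"] permutes_in_image[OF t] that by simp
    qed
    ultimately show ?thesis by (simp add: distinct_tuples_def)
  qed
  have "(\<Sum>x\<in>{x \<in> distinct_tuples k \<xi>. x j = z}. f x) = (\<Sum>x\<in>{x \<in> distinct_tuples k \<xi>. x 0 = z}. f x)"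
  proof (rule sum.reindex_bij_witness[where i="\<lambda>x. x \<circ> ?t" and j="\<lambda>x. x \<circ> ?t"])
    fix x assume x: "x \<in> {x \<in> distinct_tuples k \<xi>. x j = z}"
    then have "x \<in> {..<k} \<rightarrow>\<^sub>E UNIV" by (auto simp: distinct_tuples_def)
    then show "f (x \<circ> ?t) = f x" using f t by (simp add: sym_kernel_def)
  qed (auto simp: t_in comp_assoc)
  also have "\<dots> = (\<Sum>y\<in>distinct_tuples (k - 1) (\<xi> - {z}). f (case_nat z y))"
  proof (rule sum.reindex_bij_witness[where i="case_nat z" and j="\<lambda>x i. x (Suc i)"])
    fix x assume x: "x \<in> {x \<in> distinct_tuples k \<xi>. x 0 = z}"
    then show eq: "case_nat z (\<lambda>i. x (Suc i)) = x"
      by (auto simp: fun_eq_iff split: nat.split)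
    have x': "x \<in> {..<k} \<rightarrow>\<^sub>E \<xi>" "inj_on x {..<k}" using x by (auto simp: distinct_tuples_def)
    have "(\<lambda>i. x (Suc i)) \<in> {..<k - 1} \<rightarrow>\<^sub>E \<xi>"
    proof (rule PiE_I)
      show "x (Suc i) \<in> \<xi>" if "i \<in> {..<k - 1}" for i
        using PiE_mem[OF x'(1), of "Suc i"] that by simp
      show "x (Suc i) = undefined" if "i \<notin> {..<k - 1}" for i
        using PiE_arb[OF x'(1), of "Suc i"] that by simp
    qed
    then show "(\<lambda>i. x (Suc i)) \<in> distinct_tuples (k - 1) (\<xi> - {z})"
      unfolding distinct_tuples_local[OF k] using x' by (simp add: eq)
    show "f (case_nat z (\<lambda>i. x (Suc i))) = f x" by (simp add: eq)
  next
    fix y assume y: "y \<in> distinct_tuples (k - 1) (\<xi> - {z})"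
    then have "case_nat z y \<in> {..<k} \<rightarrow>\<^sub>E insert z \<xi>"
      unfolding distinct_tuples_local[OF k] using case_nat_in_PiE[OF k, of y \<xi> z] by simp
    then show "case_nat z y \<in> {x \<in> distinct_tuples k \<xi>. x 0 = z}"
      using y \<open>z \<in> \<xi>\<close> unfolding distinct_tuples_local[OF k]
      by (simp add: distinct_tuples_def insert_absorb)
  qed auto
  finally show ?thesis .
qed

text \<open>Real values permit the subtractions that \<open>ennreal\<close> would truncate. These
  sums are meant for finite \<open>\<xi>\<close>, since \<open>sum\<close> over an infinite index
  set is 0.\<close>

definition U_sum :: "nat \<Rightarrow> ((nat \<Rightarrow> 'a) \<Rightarrow> real) \<Rightarrow> 'a set \<Rightarrow> real" where
  "U_sum k f \<xi> = (\<Sum>x\<in>distinct_tuples k \<xi>. f x)"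

definition U_sum_local :: "nat \<Rightarrow> ((nat \<Rightarrow> 'a) \<Rightarrow> real) \<Rightarrow> 'a \<Rightarrow> 'a set \<Rightarrow> real" where
  "U_sum_local k f z \<xi> = (\<Sum>y\<in>distinct_tuples (k - 1) (\<xi> - {z}). f (case_nat z y))"

section \<open>Comparison of a U-statistic on two finite configurations\<close>

context
  fixes k :: nat and f :: "(nat \<Rightarrow> 'a::euclidean_space) \<Rightarrow> real"
  assumes k: "k \<ge> 1" and f_sym: "sym_kernel k f"
    and f_nonneg: "\<And>x. x \<in> {..<k} \<rightarrow>\<^sub>E UNIV \<Longrightarrow> f x \<ge> 0"
begin

lemma kernel_nonneg: "x \<in> distinct_tuples k \<xi> \<Longrightarrow> f x \<ge> 0"
  by (rule f_nonneg) (auto simp: distinct_tuples_def)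

lemma kernel_local_nonneg: "y \<in> distinct_tuples (k - 1) \<xi> \<Longrightarrow> f (case_nat z y) \<ge> 0"
proof (rule f_nonneg)
  assume "y \<in> distinct_tuples (k - 1) \<xi>"
  then have "y \<in> {..<k - 1} \<rightarrow>\<^sub>E UNIV" by (auto simp: distinct_tuples_def)
  from case_nat_in_PiE[OF k this, of z] show "case_nat z y \<in> {..<k} \<rightarrow>\<^sub>E UNIV" by simp
qed

lemma U_sum_nonneg: "U_sum k f \<xi> \<ge> 0"
  unfolding U_sum_def by (intro sum_nonneg kernel_nonneg)

lemma U_sum_local_nonneg: "U_sum_local k f z \<xi> \<ge> 0"
  unfolding U_sum_local_def by (intro sum_nonneg kernel_local_nonneg)

lemma U_stat_finite: "finite \<xi> \<Longrightarrow> U_stat k f \<xi> = ennreal (U_sum k f \<xi>)"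
  unfolding U_stat_def U_sum_def
  by (simp add: finite_distinct_tuples sum_ennreal kernel_nonneg)

lemma local_sq_finite: "finite \<xi> \<Longrightarrow> local_sq k f \<xi> = ennreal (\<Sum>z\<in>\<xi>. (U_sum_local k f z \<xi>)\<^sup>2)"
proof -
  assume fin: "finite \<xi>"
  have "U_stat_local k f z \<xi> = ennreal (U_sum_local k f z \<xi>)" for z
    unfolding U_stat_local_def U_sum_local_def
    using fin by (simp add: finite_distinct_tuples sum_ennreal kernel_local_nonneg)
  then show ?thesis
    unfolding local_sq_def using fin by (simp add: sum_ennreal U_sum_local_nonneg ennreal_power)
qed

text \<open>A lost tuple is charged to every pair of a position \<open>j\<close> and a point of
  \<open>\<xi> - \<zeta>\<close> sitting there, and at least one such pair exists. Each position
  contributes the same local sums, hence the factor \<open>k\<close>. Tuples of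
  \<open>\<zeta>\<close> outside \<open>\<xi>\<close> only help, as \<open>f\<close> is
  nonnegative.\<close>

lemma U_sum_le_add_local:
  assumes fin: "finite \<xi>" "finite \<zeta>"
  shows "U_sum k f \<xi> \<le> U_sum k f \<zeta> + real k * (\<Sum>z\<in>\<xi> - \<zeta>. U_sum_local k f z \<xi>)"
proof -
  let ?D = "distinct_tuples k"
  have "f x \<le> (if x \<in> ?D \<zeta> then f x else 0) + (\<Sum>j<k. \<Sum>z\<in>\<xi> - \<zeta>. if x j = z then f x else 0)"
    if x: "x \<in> ?D \<xi>" for x
  proof (cases "x \<in> ?D \<zeta>")
    case True
    then show ?thesis using kernel_nonneg[OF x] by (auto intro!: sum_nonneg)
  next
    case False
    have x': "x \<in> {..<k} \<rightarrow>\<^sub>E \<xi>" "inj_on x {..<k}" using x by (auto simp: distinct_tuples_def)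
    have "\<exists>j<k. x j \<notin> \<zeta>"
    proof (rule ccontr)
      assume "\<not> (\<exists>j<k. x j \<notin> \<zeta>)"
      then have "x \<in> {..<k} \<rightarrow>\<^sub>E \<zeta>" using PiE_arb[OF x'(1)] by (intro PiE_I) auto
      with x'(2) False show False by (simp add: distinct_tuples_def)
    qed
    then obtain j where j: "j < k" "x j \<in> \<xi> - \<zeta>" using PiE_mem[OF x'(1)] by auto
    have "f x = (\<Sum>z\<in>\<xi> - \<zeta>. if x j = z then f x else 0)"
      using fin j by simp
    also have "\<dots> \<le> (\<Sum>j<k. \<Sum>z\<in>\<xi> - \<zeta>. if x j = z then f x else 0)"
      using j kernel_nonneg[OF x]
      by (intro member_le_sum[of j _ "\<lambda>j. \<Sum>z\<in>\<xi> - \<zeta>. if x j = z then f x else 0"])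
        (auto intro!: sum_nonneg)
    finally show ?thesis using False by simp
  qed
  then have "U_sum k f \<xi> \<le> (\<Sum>x\<in>?D \<xi>. (if x \<in> ?D \<zeta> then f x else 0) +
      (\<Sum>j<k. \<Sum>z\<in>\<xi> - \<zeta>. if x j = z then f x else 0))"
    unfolding U_sum_def by (intro sum_mono)
  also have "\<dots> = (\<Sum>x\<in>?D \<xi> \<inter> ?D \<zeta>. f x) + (\<Sum>x\<in>?D \<xi>. \<Sum>j<k. \<Sum>z\<in>\<xi> - \<zeta>. if x j = z then f x else 0)"
    using fin by (simp add: sum.distrib sum.inter_restrict finite_distinct_tuples)
  also have "(\<Sum>x\<in>?D \<xi>. \<Sum>j<k. \<Sum>z\<in>\<xi> - \<zeta>. if x j = z then f x else 0) =
      (\<Sum>j<k. \<Sum>z\<in>\<xi> - \<zeta>. \<Sum>x\<in>?D \<xi>. if x j = z then f x else 0)"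
    by (subst sum.swap, intro sum.cong refl, subst sum.swap) simp
  also have "\<dots> = (\<Sum>j<k. \<Sum>z\<in>\<xi> - \<zeta>. U_sum_local k f z \<xi>)"
  proof (intro sum.cong refl)
    fix j z assume "j \<in> {..<k}" "z \<in> \<xi> - \<zeta>"
    then have "(\<Sum>x\<in>{x \<in> ?D \<xi>. x j = z}. f x) = U_sum_local k f z \<xi>"
      unfolding U_sum_local_def by (intro sum_distinct_tuples_coord f_sym) auto
    then show "(\<Sum>x\<in>?D \<xi>. if x j = z then f x else 0) = U_sum_local k f z \<xi>"
      using fin by (simp add: sum.inter_filter finite_distinct_tuples)
  qed
  also have "\<dots> = real k * (\<Sum>z\<in>\<xi> - \<zeta>. U_sum_local k f z \<xi>)"
    by simp
  also have "(\<Sum>x\<in>?D \<xi> \<inter> ?D \<zeta>. f x) \<le> U_sum k f \<zeta>"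
    unfolding U_sum_def using fin by (intro sum_mono2) (auto simp: finite_distinct_tuples kernel_nonneg)
  finally show ?thesis by simp
qed

end

section \<open>Monotonicity in the configuration and exhaustion by balls\<close>

lemma U_stat_mono: "\<xi> \<subseteq> \<zeta> \<Longrightarrow> U_stat k f \<xi> \<le> U_stat k f \<zeta>"
  unfolding U_stat_def
  by (intro infsum_mono_neutral nonneg_summable_on_complete) (auto dest: distinct_tuples_mono)

lemma local_sq_mono:
  assumes "\<xi> \<subseteq> \<zeta>"
  shows "local_sq k f \<xi> \<le> local_sq k f \<zeta>"
proof -
  have "U_stat_local k f z \<xi> \<le> U_stat_local k f z \<zeta>" for z
    unfolding U_stat_local_def
    by (intro infsum_mono_neutral nonneg_summable_on_complete) (use distinct_tuples_mono[of "\<xi> - {z}" "\<zeta> - {z}" "k - 1"] assms in auto)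
  then show ?thesis
    unfolding local_sq_def using assms
    by (intro infsum_mono_neutral nonneg_summable_on_complete) (auto intro: power_mono)
qed

text \<open>An unordered sum of nonnegative terms is the supremum of its finite partial sums, and
  finitely many tuples lie in a common ball.\<close>

lemma U_stat_ball_eventually_gt:
  fixes \<xi> :: "'a::euclidean_space set"
  assumes "t < U_stat k f \<xi>"
  shows "\<forall>\<^sub>F n in sequentially. t < U_stat k f (\<xi> \<inter> ball 0 (real n))"
proof -
  have eq: "U_stat k f \<xi> = (SUP T\<in>{T. finite T \<and> T \<subseteq> distinct_tuples k \<xi>}. \<Sum>x\<in>T. ennreal (f x))"
    for \<xi> :: "'a set"
    unfolding U_stat_def by (rule nonneg_infsum_complete) auto
  obtain T where T: "finite T" "T \<subseteq> distinct_tuples k \<xi>" "t < (\<Sum>x\<in>T. ennreal (f x))"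
    using assms unfolding eq less_SUP_iff by auto
  have "bounded (\<Union>x\<in>T. x ` {..<k})" using T(1) by (intro finite_imp_bounded) auto
  then obtain R where R: "\<And>x i. x \<in> T \<Longrightarrow> i < k \<Longrightarrow> norm (x i) \<le> R"
    unfolding bounded_iff by blast
  obtain N :: nat where N: "R < N" using reals_Archimedean2 by auto
  have "t < U_stat k f (\<xi> \<inter> ball 0 (real n))" if n: "n \<ge> N" for n
  proof -
    have "T \<subseteq> distinct_tuples k (\<xi> \<inter> ball 0 (real n))"
    proof
      fix x assume x: "x \<in> T"
      then have x': "x \<in> {..<k} \<rightarrow>\<^sub>E \<xi>" "inj_on x {..<k}" using T by (auto simp: distinct_tuples_def)
      have "x i \<in> ball 0 (real n)" if "i < k" for i
        using R[OF x that] N n by simp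
      then have "x \<in> {..<k} \<rightarrow>\<^sub>E \<xi> \<inter> ball 0 (real n)"
        using PiE_mem[OF x'(1)] PiE_arb[OF x'(1)] by (intro PiE_I) auto
      then show "x \<in> distinct_tuples k (\<xi> \<inter> ball 0 (real n))"
        using x'(2) by (simp add: distinct_tuples_def)
    qed
    then show ?thesis
      using T by (auto simp: eq less_SUP_iff)
  qed
  then show ?thesis
    unfolding eventually_sequentially by blast
qed

section \<open>Independence of the process in disjoint cells\<close>

definition indep_counts :: "'w measure \<Rightarrow> ('w \<Rightarrow> 'a::euclidean_space set) \<Rightarrow> bool" where
  "indep_counts P \<eta> \<longleftrightarrow> (\<forall>(m::nat) A. (\<forall>i<m. A i \<in> sets borel) \<longrightarrow> disjoint_family_on A {..<m} \<longrightarrow>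
        prob_space.indep_vars P (\<lambda>_. borel) (\<lambda>i \<omega>. pts_in (\<eta> \<omega>) (A i)) {..<m})"

context prob_space
begin

lemma indep_counts_finite:
  fixes \<eta> :: "'a \<Rightarrow> 'b::euclidean_space set" and A :: "'k \<Rightarrow> 'b set"
  assumes ind: "indep_counts M \<eta>" and "finite K"
    and A: "\<And>k. k \<in> K \<Longrightarrow> A k \<in> sets borel" "disjoint_family_on A K"
  shows "indep_vars (\<lambda>_. borel) (\<lambda>k \<omega>. pts_in (\<eta> \<omega>) (A k)) K"
proof -
  obtain e where e: "bij_betw e {..<card K} K"
    using ex_bij_betw_nat_finite[OF \<open>finite K\<close>] by (auto simp: atLeast0LessThan)
  define g where "g = inv_into {..<card K} e"
  have g: "bij_betw g K {..<card K}" unfolding g_def by (rule bij_betw_inv_into[OF e])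
  have eg: "e (g k) = k" if "k \<in> K" for k
    unfolding g_def using e that by (simp add: bij_betw_inv_into_right)
  have "\<forall>i<card K. A (e i) \<in> sets borel"
    using A(1) bij_betwE[OF e] by auto
  moreover have "disjoint_family_on (\<lambda>i. A (e i)) {..<card K}"
    using A(2) e unfolding disjoint_family_on_def bij_betw_def inj_on_def by (metis imageI)
  ultimately have "indep_vars (\<lambda>_. borel) (\<lambda>i \<omega>. pts_in (\<eta> \<omega>) (A (e i))) {..<card K}"
    using ind[unfolded indep_counts_def, rule_format, of "card K" "\<lambda>i. A (e i)"] by blast
  \<comment> \<open>Grouping into singleton blocks \<open>{g k}\<close> and projecting each block
    onto its only entry reindexes the family along the bijection.\<close>
  then have "indep_vars (\<lambda>k. PiM {g k} (\<lambda>_. borel)) (\<lambda>k \<omega>. \<lambda>i\<in>{g k}. pts_in (\<eta> \<omega>) (A (e i))) K"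
    using g by (intro indep_vars_restrict) (auto simp: bij_betw_def disjoint_family_on_def inj_on_def)
  then have "indep_vars (\<lambda>_. borel) (\<lambda>k \<omega>. (\<lambda>v. v (g k)) (\<lambda>i\<in>{g k}. pts_in (\<eta> \<omega>) (A (e i)))) K"
    by (rule indep_vars_compose2) (auto intro: measurable_component_singleton)
  also have "?this \<longleftrightarrow> indep_vars (\<lambda>_. borel) (\<lambda>k \<omega>. pts_in (\<eta> \<omega>) (A k)) K"
    by (rule indep_vars_cong) (auto simp: eg)
  finally show ?thesis .
qed

text \<open>The test sets in \<open>J\<close> may overlap. Cutting every cell into the atoms of the
  finite algebra generated by \<open>J\<close> gives sets that are all disjoint, so their counts are
  independent; the vector of a cell is a function of the counts of its own atoms.\<close>

lemma indep_count_vectors: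
  fixes \<eta> :: "'a \<Rightarrow> 'b::euclidean_space set" and C :: "'i \<Rightarrow> 'b set"
  assumes ind: "indep_counts M \<eta>" and I: "finite I"
    and C: "\<And>i. i \<in> I \<Longrightarrow> C i \<in> sets borel" "disjoint_family_on C I"
    and J: "finite J" "J \<subseteq> sets borel"
  shows "indep_vars (\<lambda>_. PiM J (\<lambda>_. borel)) (\<lambda>i \<omega>. \<lambda>B\<in>J. pts_in (\<eta> \<omega>) (C i \<inter> B)) I"
proof -
  define atom where "atom = (\<lambda>(i, S). {x \<in> C i. \<forall>B\<in>J. x \<in> B \<longleftrightarrow> B \<in> S})"
  define K where "K i = {i} \<times> Pow J" for i :: 'i
  have atom_eq: "atom (i, S) = C i \<inter> (\<Inter>B\<in>J. if B \<in> S then B else - B)" for i S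
    by (auto simp: atom_def split: if_splits)
  have atom_borel: "atom p \<in> sets borel" if "p \<in> I \<times> Pow J" for p
  proof (cases p)
    case (Pair i S)
    have "(if B \<in> S then B else - B) \<in> sets borel" if "B \<in> J" for B
      using that J(2) by (auto simp: borel_comp)
    moreover have "C i \<in> sets borel" using C(1) that Pair by auto
    ultimately have "C i \<inter> (\<Inter>B\<in>J. if B \<in> S then B else - B) \<in> sets borel" if "J \<noteq> {}"
      using J(1) that by (intro sets.Int sets.finite_INT) blast+
    then show ?thesis
      unfolding Pair atom_eq using \<open>C i \<in> sets borel\<close> by (cases "J = {}") auto
  qed
  have atom_disj: "disjoint_family_on atom (I \<times> Pow J)"
    unfolding disjoint_family_on_def
  proof (intro ballI impI)
    fix p q assume p: "p \<in> I \<times> Pow J" and q: "q \<in> I \<times> Pow J" and "p \<noteq> q"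
    obtain i S i' S' where [simp]: "p = (i, S)" "q = (i', S')" by (cases p, cases q)
    show "atom p \<inter> atom q = {}"
    proof (rule ccontr)
      assume "atom p \<inter> atom q \<noteq> {}"
      then obtain x where x: "x \<in> atom p" "x \<in> atom q" by auto
      then have "i = i'"
        using C(2) p q by (auto simp: atom_def disjoint_family_on_def)
      moreover have "S = S'" using x p q by (auto simp: atom_def)
      ultimately show False using \<open>p \<noteq> q\<close> by simp
    qed
  qed
  have "indep_vars (\<lambda>_. borel) (\<lambda>p \<omega>. pts_in (\<eta> \<omega>) (atom p)) (I \<times> Pow J)"
    using I J by (intro indep_counts_finite[OF ind] atom_borel atom_disj) auto
  then have "indep_vars (\<lambda>i. PiM (K i) (\<lambda>_. borel)) (\<lambda>i \<omega>. \<lambda>p\<in>K i. pts_in (\<eta> \<omega>) (atom p)) I"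
    by (rule indep_vars_restrict) (auto simp: K_def disjoint_family_on_def)
  then have "indep_vars (\<lambda>_. PiM J (\<lambda>_. borel))
      (\<lambda>i \<omega>. (\<lambda>v. \<lambda>B\<in>J. \<Sum>S\<in>{S \<in> Pow J. B \<in> S}. v (i, S)) (\<lambda>p\<in>K i. pts_in (\<eta> \<omega>) (atom p))) I"
  proof (rule indep_vars_compose2)
    fix i assume "i \<in> I"
    show "(\<lambda>v. \<lambda>B\<in>J. \<Sum>S\<in>{S \<in> Pow J. B \<in> S}. v (i, S) :: ennreal)
        \<in> measurable (PiM (K i) (\<lambda>_. borel)) (PiM J (\<lambda>_. borel))"
      by (intro measurable_restrict borel_measurable_sum measurable_component_singleton)
        (auto simp: K_def)
  qed
  also have "?this \<longleftrightarrow> ?thesis"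
  proof (intro indep_vars_cong refl ext)
    fix i \<omega> B assume i: "i \<in> I"
    have "pts_in (\<eta> \<omega>) (C i \<inter> B) = (\<Sum>S\<in>{S \<in> Pow J. B \<in> S}. pts_in (\<eta> \<omega>) (atom (i, S)))" if "B \<in> J"
    proof -
      have "\<eta> \<omega> \<inter> (C i \<inter> B) = (\<Union>S\<in>{S \<in> Pow J. B \<in> S}. \<eta> \<omega> \<inter> atom (i, S))"
      proof (intro equalityI subsetI)
        fix x assume "x \<in> \<eta> \<omega> \<inter> (C i \<inter> B)"
        then have "x \<in> \<eta> \<omega> \<inter> atom (i, {B \<in> J. x \<in> B})" "{B \<in> J. x \<in> B} \<in> {S \<in> Pow J. B \<in> S}"
          using that by (auto simp: atom_def)
        then show "x \<in> (\<Union>S\<in>{S \<in> Pow J. B \<in> S}. \<eta> \<omega> \<inter> atom (i, S))" by blast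
      qed (use that in \<open>auto simp: atom_def\<close>)
      moreover have "disjoint_family_on (\<lambda>S. \<eta> \<omega> \<inter> atom (i, S)) {S \<in> Pow J. B \<in> S}"
        using atom_disj i unfolding disjoint_family_on_def by blast
      ultimately show ?thesis
        unfolding pts_in_def using J(1) by (simp add: sum_emeasure)
    qed
    then show "(\<lambda>B\<in>J. \<Sum>S\<in>{S \<in> Pow J. B \<in> S}. (\<lambda>p\<in>K i. pts_in (\<eta> \<omega>) (atom p)) (i, S)) B =
        (\<lambda>B\<in>J. pts_in (\<eta> \<omega>) (C i \<inter> B)) B"
      by (auto simp: K_def restrict_def intro!: sum.cong)
  qed
  finally show ?thesis .
qed

text \<open>Events on the counts of finitely many test sets form an intersection-stable family
  \<open>E i\<close> that generates all events determined by the configuration in the cell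
  \<open>C i\<close>. Independence on these generators passes to the generated
  sigma-algebras.\<close>

lemma indep_cells:
  fixes \<eta> :: "'a \<Rightarrow> 'b::euclidean_space set" and C :: "'i \<Rightarrow> 'b set"
  assumes ind: "indep_counts M \<eta>" and \<eta>: "\<eta> \<in> measurable M config_space" and I: "finite I"
    and C: "\<And>i. i \<in> I \<Longrightarrow> C i \<in> sets borel" "disjoint_family_on C I"
  shows "indep_vars (\<lambda>_. config_space) (\<lambda>i \<omega>. \<eta> \<omega> \<inter> C i) I"
proof -
  define G where "G i J V = {\<omega> \<in> space M. \<forall>B\<in>J. pts_in (\<eta> \<omega>) (C i \<inter> B) \<in> V B}"
    for i J and V :: "'b set \<Rightarrow> ennreal set"
  define E where "E i = {G i J V | J V. finite J \<and> J \<subseteq> sets borel \<and> (\<forall>B. V B \<in> sets borel)}" for i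
  have X: "(\<lambda>\<omega>. \<eta> \<omega> \<inter> C i) \<in> measurable M config_space" if "i \<in> I" for i
    by (rule measurable_compose[OF \<eta> measurable_Int_config_space[OF C(1)[OF that]]])
  have vec: "(\<lambda>\<omega>. \<lambda>B\<in>J. pts_in (\<eta> \<omega>) (C i \<inter> B)) -` (PiE J V) \<inter> space M = G i J V" for i J V
    by (auto simp: G_def PiE_iff)
  have vec_sets: "PiE J V \<in> sets (PiM J (\<lambda>_. borel))"
    if "finite J" "\<forall>B. V B \<in> sets borel" for J and V :: "'b set \<Rightarrow> ennreal set"
    using that by (intro sets_PiM_I_finite) auto
  have "indep_sets E I"
  proof (rule indep_setsI)
    fix i assume i: "i \<in> I"
    show "E i \<subseteq> events"
    proof
      fix D assume "D \<in> E i"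
      then obtain J V where D: "D = G i J V" and J: "finite J" "J \<subseteq> sets borel" "\<forall>B. V B \<in> sets borel"
        by (auto simp: E_def)
      have "(\<lambda>\<omega>. \<lambda>B\<in>J. pts_in (\<eta> \<omega>) (C i \<inter> B)) \<in> measurable M (PiM J (\<lambda>_. borel))"
        using J i C(1) by (intro measurable_restrict measurable_compose[OF \<eta> measurable_pts_in]) auto
      from measurable_sets[OF this vec_sets[OF J(1,3)]] show "D \<in> events"
        by (simp add: vec D)
    qed
  next
    fix D K assume K: "K \<noteq> {}" "K \<subseteq> I" "finite K" and D: "\<forall>j\<in>K. D j \<in> E j"
    from D have "\<forall>j\<in>K. \<exists>J V. D j = G j J V \<and> finite J \<and> J \<subseteq> sets borel \<and> (\<forall>B. V B \<in> sets borel)"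
      unfolding E_def by blast
    then obtain J V where JV: "\<And>j. j \<in> K \<Longrightarrow> D j = G j (J j) (V j)" "\<And>j. j \<in> K \<Longrightarrow> finite (J j)"
      "\<And>j. j \<in> K \<Longrightarrow> J j \<subseteq> sets borel" "\<And>j B. j \<in> K \<Longrightarrow> V j B \<in> sets borel"
      by metis
    \<comment> \<open>Different cells may come with different test sets. All are enlarged to the
      common union, with the trivial constraint \<open>UNIV\<close> for the added sets.\<close>
    define JJ where "JJ = (\<Union>j\<in>K. J j)"
    define W where "W j B = (if B \<in> J j then V j B else UNIV)" for j B
    have JJ: "finite JJ" "JJ \<subseteq> sets borel" using JV(2,3) K unfolding JJ_def by (blast intro: finite_UN_I)+
    have DW: "D j = G j JJ (W j)" if "j \<in> K" for j
      using that by (auto simp: JV(1)[OF that] G_def JJ_def W_def)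
    have W: "\<forall>B. W j B \<in> sets borel" if "j \<in> K" for j
      using JV(4)[OF that] by (auto simp: W_def)
    show "prob (\<Inter>j\<in>K. D j) = (\<Prod>j\<in>K. prob (D j))"
      using indep_varsD[OF indep_count_vectors[OF ind I C JJ] K(1,3,2), of "\<lambda>j. PiE JJ (W j)"]
        vec_sets[OF JJ(1) W] by (simp add: vec DW)
  qed
  moreover have "Int_stable (E i)" for i
  proof (rule Int_stableI)
    fix D D' assume "D \<in> E i" "D' \<in> E i"
    then obtain J V J' V' where *: "D = G i J V" "D' = G i J' V'" "finite J" "J \<subseteq> sets borel"
      "\<forall>B. V B \<in> sets borel" "finite J'" "J' \<subseteq> sets borel" "\<forall>B. V' B \<in> sets borel"
      unfolding E_def by blast
    define W where "W B = (if B \<in> J then V B else UNIV) \<inter> (if B \<in> J' then V' B else UNIV)" for B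
    have "D \<inter> D' = G i (J \<union> J') W" by (auto simp: *(1,2) G_def W_def)
    moreover have "\<forall>B. W B \<in> sets borel" using * by (auto simp: W_def)
    ultimately show "D \<inter> D' \<in> E i"
      unfolding E_def using * by blast
  qed
  ultimately have "indep_sets (\<lambda>i. sigma_sets (space M) (E i)) I"
    by (rule indep_sets_sigma)
  then have "indep_sets (\<lambda>i. {(\<lambda>\<omega>. \<eta> \<omega> \<inter> C i) -` A \<inter> space M | A. A \<in> sets config_space}) I"
  proof (rule indep_sets_mono_sets)
    fix i assume i: "i \<in> I"
    have EP: "E i \<subseteq> Pow (space M)" by (auto simp: E_def G_def)
    have "(\<lambda>\<omega>. \<eta> \<omega> \<inter> C i) \<in> measurable (sigma (space M) (E i)) config_space"
    proof (rule measurable_config_spaceI)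
      fix \<omega> assume "\<omega> \<in> space (sigma (space M) (E i))"
      then have "\<omega> \<in> space M" using EP by (simp add: space_measure_of_conv)
      then show "\<eta> \<omega> \<inter> C i \<in> loc_finite_sets"
        using measurable_space[OF X[OF i]] by (simp add: space_config_space)
    next
      fix B :: "'b set" assume B: "B \<in> sets borel"
      show "(\<lambda>\<omega>. pts_in (\<eta> \<omega> \<inter> C i) B) \<in> borel_measurable (sigma (space M) (E i))"
      proof (rule measurableI)
        fix V :: "ennreal set" assume "V \<in> sets borel"
        then have "G i {B} (\<lambda>_. V) \<in> E i" unfolding E_def using B by blast
        moreover have "(\<lambda>\<omega>. pts_in (\<eta> \<omega> \<inter> C i) B) -` V \<inter> space (sigma (space M) (E i)) = G i {B} (\<lambda>_. V)"
          using EP by (auto simp: G_def pts_in_Int space_measure_of_conv)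
        ultimately show "(\<lambda>\<omega>. pts_in (\<eta> \<omega> \<inter> C i) B) -` V \<inter> space (sigma (space M) (E i)) \<in> sets (sigma (space M) (E i))"
          using EP by (auto simp: sets_measure_of)
      qed simp
    qed
    from measurable_sets[OF this] show "{(\<lambda>\<omega>. \<eta> \<omega> \<inter> C i) -` A \<inter> space M | A. A \<in> sets config_space} \<subseteq>
      sigma_sets (space M) (E i)"
      using EP by (auto simp: sets_measure_of space_measure_of_conv)
  qed
  then show ?thesis
    unfolding indep_vars_def2 using X by auto
qed

end

section \<open>Concentration around levels\<close>

lemma non_atomic_singleton:
  fixes \<mu> :: "'a::euclidean_space measure"
  assumes "loc_finite_measure \<mu>" "non_atomic \<mu>"
  shows "emeasure \<mu> {x} = 0"
proof (rule ccontr)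
  assume "emeasure \<mu> {x} \<noteq> 0"
  moreover have "{x} \<in> sets \<mu>" using assms(1) by (simp add: loc_finite_measure_def)
  ultimately obtain B where "B \<subseteq> {x}" "0 < emeasure \<mu> B" "emeasure \<mu> B < emeasure \<mu> {x}"
    using assms(2) unfolding non_atomic_def by (metis gr_zeroI)
  then show False by (auto simp: subset_singleton_iff)
qed

lemma small_ball:
  fixes \<mu> :: "'a::euclidean_space measure"
  assumes lf: "loc_finite_measure \<mu>" and na: "non_atomic \<mu>" and "0 < (e::ennreal)"
  shows "\<exists>d>0. emeasure \<mu> (ball x d) < e"
proof -
  have sets_\<mu>: "sets \<mu> = sets borel" using lf by (simp add: loc_finite_measure_def)
  let ?B = "\<lambda>n::nat. ball x (1 / Suc n)"
  have "(\<Inter>n. ?B n) = {x}"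
  proof (intro equalityI subsetI)
    fix y assume y: "y \<in> (\<Inter>n. ?B n)"
    have "\<not> 0 < dist x y"
    proof
      assume "0 < dist x y"
      then obtain n where "1 / Suc n < dist x y"
        using reals_Archimedean[of "dist x y"] by (auto simp: inverse_eq_divide)
      moreover have "dist x y < 1 / Suc n" using y by (meson INT_E UNIV_I mem_ball)
      ultimately show False by simp
    qed
    then show "y \<in> {x}" by simp
  qed auto
  moreover have "(\<lambda>n. emeasure \<mu> (?B n)) \<longlonglongrightarrow> emeasure \<mu> (\<Inter>n. ?B n)"
  proof (rule Lim_emeasure_decseq)
    show "decseq ?B" by (auto simp: decseq_def intro!: subset_ball frac_le)
    show "emeasure \<mu> (?B n) \<noteq> \<infinity>" for n
      using lf bounded_ball[of x "1 / Suc n"] unfolding loc_finite_measure_def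
      by (metis borel_open open_ball less_irrefl)
  qed (auto simp: sets_\<mu>)
  ultimately have "(\<lambda>n. emeasure \<mu> (?B n)) \<longlonglongrightarrow> 0"
    using non_atomic_singleton[OF lf na] by simp
  from order_tendstoD(2)[OF this \<open>0 < e\<close>] obtain n where "emeasure \<mu> (?B n) < e"
    by (auto simp: eventually_sequentially)
  then show ?thesis by (intro exI[of _ "1 / Suc n"]) auto
qed

text \<open>Points are null sets, so every point is the centre of a ball of measure below
  \<open>e\<close>. By compactness finitely many of these balls cover the window, and making them
  disjoint only decreases their measures.\<close>

lemma fine_partition:
  fixes \<mu> :: "'a::euclidean_space measure"
  assumes lf: "loc_finite_measure \<mu>" and na: "non_atomic \<mu>" and "0 < (e::ennreal)"
  obtains C :: "nat \<Rightarrow> 'a set" and m where "\<And>i. C i \<in> sets borel" "disjoint_family C"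
    "(\<Union>i<m. C i) = ball 0 R" "\<And>i. i < m \<Longrightarrow> emeasure \<mu> (C i) \<le> e" "0 < m"
proof -
  have sets_\<mu>: "sets \<mu> = sets borel" using lf by (simp add: loc_finite_measure_def)
  obtain d where d: "\<And>x. 0 < d x" "\<And>x. emeasure \<mu> (ball x (d x)) < e"
    using small_ball[OF assms] by metis
  have "cball 0 R \<subseteq> (\<Union>x\<in>UNIV. ball x (d x))"
  proof
    show "x \<in> (\<Union>x\<in>UNIV. ball x (d x))" for x
      by (rule UN_I[of x]) (simp_all add: d(1))
  qed
  then obtain D where D: "finite D" "cball 0 R \<subseteq> (\<Union>x\<in>D. ball x (d x))"
    by (rule compactE_image[OF compact_cball open_ball])
  obtain xs where xs: "set xs = D" using finite_list[OF D(1)] by auto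
  \<comment> \<open>The extra centre 0 keeps the number of cells positive even when \<open>D\<close>
    is empty; the later identification of a joint law with a product measure takes a nonempty index
    set.\<close>
  define ys where "ys = 0 # xs"
  define m where "m = length ys"
  define U where "U i = (if i < m then ball (ys ! i) (d (ys ! i)) else {})" for i
  define C where "C i = disjointed U i \<inter> ball 0 R" for i
  show ?thesis
  proof (rule that)
    have U: "U i \<in> sets borel" for i by (auto simp: U_def)
    show borel: "C i \<in> sets borel" for i
      unfolding C_def disjointed_def using U by auto
    show "disjoint_family C"
      using disjoint_family_disjointed[of U] by (auto simp: C_def disjoint_family_on_def)
    show "0 < m" by (simp add: m_def ys_def)
    have "(\<Union>i<m. C i) = (\<Union>i\<in>{0..<m}. disjointed U i) \<inter> ball 0 R"
      by (auto simp: C_def)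
    also have "\<dots> = (\<Union>i\<in>{0..<m}. U i) \<inter> ball 0 R"
      by (simp add: finite_UN_disjointed_eq)
    also have "ball 0 R \<subseteq> (\<Union>i\<in>{0..<m}. U i)"
    proof
      fix y :: 'a assume "y \<in> ball 0 R"
      then have "y \<in> (\<Union>x\<in>D. ball x (d x))" using D(2) by (auto simp: subset_iff)
      then obtain x where x: "x \<in> set ys" "y \<in> ball x (d x)" using xs unfolding ys_def by auto
      then obtain i where "i < m" "ys ! i = x" by (auto simp: in_set_conv_nth m_def)
      with x(2) show "y \<in> (\<Union>i\<in>{0..<m}. U i)" by (auto simp: U_def)
    qed
    then have "(\<Union>i\<in>{0..<m}. U i) \<inter> ball 0 R = ball 0 R" by blast
    finally show "(\<Union>i<m. C i) = ball 0 R" .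
    show "emeasure \<mu> (C i) \<le> e" if "i < m" for i
    proof -
      have "emeasure \<mu> (C i) \<le> emeasure \<mu> (ball (ys ! i) (d (ys ! i)))"
        using that disjointed_subset[of U i] by (intro emeasure_mono) (auto simp: C_def U_def sets_\<mu>)
      also have "\<dots> \<le> e" using d(2) by (rule less_imp_le)
      finally show ?thesis .
    qed
  qed
qed

text \<open>For intensity \<open>l\<close> the probability is
  \<open>1 - (1 + l) * exp (- l) \<le> 1 - (1 + l) * (1 - l) = l^2\<close>. Because the bound is
  quadratic, its sum over many small cells is still small.\<close>

lemma poisson_two_points:
  fixes \<mu> :: "'a::euclidean_space measure"
  assumes pp: "poisson_process P \<eta> \<mu>" and A: "A \<in> sets borel" "emeasure \<mu> A < \<infinity>"
  shows "measure P {\<omega> \<in> space P. \<not> pts_in (\<eta> \<omega>) A \<le> 1} \<le> (measure \<mu> A)\<^sup>2"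
proof -
  interpret prob_space P using pp by (simp add: poisson_process_def)
  have \<eta>: "\<eta> \<in> measurable P config_space" using pp by (simp add: poisson_process_def)
  define N where "N \<omega> = pts_in (\<eta> \<omega>) A" for \<omega>
  have [measurable]: "N \<in> borel_measurable P"
    unfolding N_def by (rule measurable_compose[OF \<eta> measurable_pts_in[OF A(1)]])
  define l where "l = measure \<mu> A"
  have pois: "prob {\<omega> \<in> space P. N \<omega> = of_nat n} = l ^ n / fact n * exp (- l)" for n
    using pp A by (simp add: poisson_process_def N_def l_def)
  have "prob {\<omega> \<in> space P. N \<omega> = 0} + prob {\<omega> \<in> space P. N \<omega> = 1} =
      prob ({\<omega> \<in> space P. N \<omega> = 0} \<union> {\<omega> \<in> space P. N \<omega> = 1})"
    by (intro finite_measure_Union[symmetric]) auto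
  also have "\<dots> \<le> prob {\<omega> \<in> space P. N \<omega> \<le> 1}"
    by (intro finite_measure_mono) auto
  finally have "prob {\<omega> \<in> space P. N \<omega> \<le> 1} \<ge> (1 + l) * exp (- l)"
    using pois[of 0] pois[of 1] by (simp add: algebra_simps)
  moreover have "(1 + l) * exp (- l) \<ge> (1 + l) * (1 - l)"
    using exp_ge_add_one_self[of "- l"] by (intro mult_left_mono) (auto simp: l_def)
  moreover have "prob {\<omega> \<in> space P. \<not> N \<omega> \<le> 1} = 1 - prob {\<omega> \<in> space P. N \<omega> \<le> 1}"
    by (rule prob_neg) measurable
  ultimately show ?thesis by (simp add: N_def l_def power2_eq_square algebra_simps)
qed

text \<open>A coordinate of a point of the product space is an arbitrary configuration and may leave
  its cell, hence the intersection with \<open>C i\<close>.\<close>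

definition glue :: "nat \<Rightarrow> (nat \<Rightarrow> 'a set) \<Rightarrow> (nat \<Rightarrow> 'a set) \<Rightarrow> 'a set" where
  "glue m C x = (\<Union>i<m. x i \<inter> C i)"

lemma measurable_glue:
  fixes C :: "nat \<Rightarrow> 'a::euclidean_space set"
  assumes C: "\<And>i. C i \<in> sets borel" "disjoint_family C"
    and M: "\<And>i. sets (M i) = sets config_space"
  shows "glue m C \<in> measurable (PiM {..<m} M) config_space"
proof (rule measurable_config_spaceI)
  have space_M: "space (M i) = loc_finite_sets" for i
    using sets_eq_imp_space_eq[OF M] by (simp add: space_config_space)
  show "glue m C x \<in> loc_finite_sets" if "x \<in> space (PiM {..<m} M)" for x
  proof -
    have fin: "finite (x i \<inter> C i \<inter> B)" if "i < m" "bounded B" for i B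
    proof -
      have "x i \<in> loc_finite_sets"
        using \<open>x \<in> space (PiM {..<m} M)\<close> that by (auto simp: space_PiM space_M dest: PiE_mem)
      then show ?thesis using that by (auto simp: loc_finite_sets_def intro: finite_subset[of _ "x i \<inter> B"])
    qed
    show ?thesis unfolding loc_finite_sets_def
    proof (intro CollectI allI impI)
      fix B :: "'a set" assume "bounded B"
      have "glue m C x \<inter> B = (\<Union>i<m. x i \<inter> C i \<inter> B)" by (auto simp: glue_def)
      also have "finite \<dots>" using fin[OF _ \<open>bounded B\<close>] by (intro finite_UN_I) auto
      finally show "finite (glue m C x \<inter> B)" .
    qed
  qed
  fix A :: "'a set" assume A: "A \<in> sets borel"
  have "pts_in (glue m C x) A = (\<Sum>i<m. pts_in (x i) (C i \<inter> A))" for x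
  proof -
    have "glue m C x \<inter> A = (\<Union>i<m. x i \<inter> (C i \<inter> A))" by (auto simp: glue_def)
    moreover have "disjoint_family_on (\<lambda>i. x i \<inter> (C i \<inter> A)) {..<m}"
      using C(2) by (auto simp: disjoint_family_on_def)
    ultimately show ?thesis unfolding pts_in_def by (simp add: sum_emeasure)
  qed
  moreover have "(\<lambda>x. pts_in (x i) (C i \<inter> A)) \<in> borel_measurable (PiM {..<m} M)" if "i < m" for i
  proof (rule measurable_compose[OF measurable_component_singleton])
    show "(\<lambda>\<xi>. pts_in \<xi> (C i \<inter> A)) \<in> borel_measurable (M i)"
      using measurable_pts_in[OF sets.Int[OF C(1)[of i] A]] measurable_cong_sets[OF M refl] by blast
  qed (use that in simp)
  ultimately show "(\<lambda>x. pts_in (glue m C x) A) \<in> borel_measurable (PiM {..<m} M)"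
    by simp
qed

section \<open>Weights for the convex distance on a product of cells\<close>

lemma sum_cells:
  fixes L :: "'a \<Rightarrow> real"
  assumes "disjoint_family C" "\<And>i. i < m \<Longrightarrow> finite (x i \<inter> C i)"
  shows "(\<Sum>z\<in>glue m C x. L z) = (\<Sum>i<m. \<Sum>z\<in>x i \<inter> C i. L z)"
  unfolding glue_def using assms
  by (intro sum.UNION_disjoint) (auto simp: disjoint_family_on_def)

text \<open>The weight of a cell is the sum of the local values of its points, divided by the root
  of the total sum of squares. If \<open>x\<close> and \<open>y\<close> agree in a cell, no point of
  \<open>x\<close> there is missing from \<open>glue m C y\<close>. So all missing points lie in
  cells that the distance counts, and their local values control the excess over
  \<open>b\<close>.\<close>

lemma U_sum_cells:
  fixes f :: "(nat \<Rightarrow> 'a::euclidean_space) \<Rightarrow> real"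
  assumes k: "k \<ge> 1" and f: "sym_kernel k f" "\<And>x. x \<in> {..<k} \<rightarrow>\<^sub>E UNIV \<Longrightarrow> f x \<ge> 0"
    and C: "disjoint_family C"
    and fin: "\<And>i. i < m \<Longrightarrow> finite (x i \<inter> C i)"
    and one: "\<And>i. i < m \<Longrightarrow> card (x i \<inter> C i) \<le> 1"
    and s: "s \<ge> 0"
    and gt: "U_sum k f (glue m C x) > b + s * real k * sqrt (\<Sum>z\<in>glue m C x. (U_sum_local k f z (glue m C x))\<^sup>2)"
    and A: "\<And>y. y \<in> A \<Longrightarrow> U_sum k f (glue m C y) \<le> b \<and> finite (glue m C y)"
  shows "\<exists>u. (\<forall>i\<in>{..<m}. u i \<ge> 0) \<and> (\<Sum>i<m. (u i)\<^sup>2) \<le> 1 \<and>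
     (\<forall>y\<in>A. s \<le> (\<Sum>i<m. if y i \<noteq> x i then u i else 0))"
proof (cases "A = {}")
  case True
  then show ?thesis by (intro exI[of _ "\<lambda>_. 0"]) auto
next
  case False
  define \<xi> where "\<xi> = glue m C x"
  define L where "L z = U_sum_local k f z \<xi>" for z
  define V where "V = (\<Sum>z\<in>\<xi>. (L z)\<^sup>2)"
  have fin\<xi>: "finite \<xi>" unfolding \<xi>_def glue_def using fin by auto
  have L_nonneg: "L z \<ge> 0" for z unfolding L_def by (rule U_sum_local_nonneg[OF k f])
  have gt': "U_sum k f \<xi> > b + s * real k * sqrt V" using gt by (simp add: \<xi>_def V_def L_def)
  have le: "U_sum k f \<xi> - b \<le> real k * (\<Sum>z\<in>\<xi> - glue m C y. L z)" if "y \<in> A" for y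
    using U_sum_le_add_local[OF k f fin\<xi>, of "glue m C y"] A[OF that] by (simp add: L_def)
  \<comment> \<open>Here a member of \<open>A\<close> enters, hence the separate case of empty
    \<open>A\<close>: if all local values vanished, comparison with that member would give
    \<open>U_sum k f \<xi> \<le> b\<close>.\<close>
  have "V \<noteq> 0"
  proof
    assume "V = 0"
    then have "L z = 0" if "z \<in> \<xi>" for z
      using that fin\<xi> unfolding V_def by (simp add: sum_nonneg_eq_0_iff)
    moreover obtain y where "y \<in> A" using False by auto
    ultimately have "U_sum k f \<xi> \<le> b" using le[of y] by simp
    then show False using gt' \<open>V = 0\<close> by simp
  qed
  moreover have "V \<ge> 0" unfolding V_def by (intro sum_nonneg) auto
  ultimately have V: "V > 0" by simp
  define u where "u i = (\<Sum>z\<in>x i \<inter> C i. L z) / sqrt V" for i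
  have u_nonneg: "u i \<ge> 0" for i unfolding u_def using V L_nonneg by (intro divide_nonneg_pos sum_nonneg) auto
  \<comment> \<open>The place where at most one point per cell matters: with several points the
    square of the sum could exceed the sum of squares, and \<open>u\<close> could have norm above
    1.\<close>
  have sq: "(\<Sum>z\<in>x i \<inter> C i. L z)\<^sup>2 = (\<Sum>z\<in>x i \<inter> C i. (L z)\<^sup>2)" if "i < m" for i
  proof -
    have "card (x i \<inter> C i) = 0 \<or> card (x i \<inter> C i) = 1" using one[OF that] by linarith
    then show ?thesis using fin[OF that] by (auto simp: card_1_singleton_iff)
  qed
  have "(\<Sum>i<m. (u i)\<^sup>2) = (\<Sum>i<m. \<Sum>z\<in>x i \<inter> C i. (L z)\<^sup>2) / V"
    unfolding sum_divide_distrib[of _ "{..<m}"] using V sq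
    by (intro sum.cong refl) (simp add: u_def power_divide)
  also have "\<dots> = 1"
    using V sum_cells[OF C fin, where L="\<lambda>z. (L z)\<^sup>2"] by (simp add: V_def \<xi>_def)
  finally have u_sq: "(\<Sum>i<m. (u i)\<^sup>2) \<le> 1" by simp
  have "s \<le> (\<Sum>i<m. if y i \<noteq> x i then u i else 0)" if y: "y \<in> A" for y
  proof -
    have "(\<Sum>z\<in>\<xi> - glue m C y. L z) = (\<Sum>z\<in>\<xi>. if z \<notin> glue m C y then L z else 0)"
      using fin\<xi> by (simp add: set_diff_eq sum.inter_filter)
    also have "\<dots> = (\<Sum>i<m. \<Sum>z\<in>x i \<inter> C i. if z \<notin> glue m C y then L z else 0)"
      unfolding \<xi>_def by (rule sum_cells[OF C fin])
    also have "\<dots> \<le> (\<Sum>i<m. if y i \<noteq> x i then sqrt V * u i else 0)"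
    proof (rule sum_mono)
      fix i assume i: "i \<in> {..<m}"
      show "(\<Sum>z\<in>x i \<inter> C i. if z \<notin> glue m C y then L z else 0) \<le> (if y i \<noteq> x i then sqrt V * u i else 0)"
      proof (cases "y i = x i")
        case True
        then show ?thesis using i by (auto simp: glue_def intro!: sum_nonpos)
      next
        case False
        have "(\<Sum>z\<in>x i \<inter> C i. if z \<notin> glue m C y then L z else 0) \<le> (\<Sum>z\<in>x i \<inter> C i. L z)"
          using L_nonneg by (intro sum_mono) auto
        then show ?thesis using False V by (simp add: u_def)
      qed
    qed
    also have "\<dots> = sqrt V * (\<Sum>i<m. if y i \<noteq> x i then u i else 0)"
      by (auto simp: sum_distrib_left intro!: sum.cong)
    finally have "real k * (\<Sum>z\<in>\<xi> - glue m C y. L z) \<le> real k * (sqrt V * (\<Sum>i<m. if y i \<noteq> x i then u i else 0))"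
      by (rule mult_left_mono) simp
    with le[OF y] gt' have "(real k * sqrt V) * s \<le> (real k * sqrt V) * (\<Sum>i<m. if y i \<noteq> x i then u i else 0)"
      by (simp add: algebra_simps)
    then show ?thesis using V k by (simp add: mult_le_cancel_left)
  qed
  with u_nonneg u_sq show ?thesis by blast
qed

lemma window_concentration:
  fixes \<mu> :: "'a::euclidean_space measure" and \<eta> :: "'w \<Rightarrow> 'a set" and f :: "(nat \<Rightarrow> 'a) \<Rightarrow> real" and R b s :: real
  assumes lf: "loc_finite_measure \<mu>" and na: "non_atomic \<mu>"
    and pp: "poisson_process P \<eta> \<mu>"
    and k: "k \<ge> 1" and f: "sym_kernel k f" "\<And>x. x \<in> {..<k} \<rightarrow>\<^sub>E UNIV \<Longrightarrow> f x \<ge> 0"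
    and s: "s \<ge> 0"
  defines "W \<equiv> \<lambda>\<omega>. \<eta> \<omega> \<inter> ball 0 R"
  shows "measure P {\<omega> \<in> space P. enn2real (U_stat k f (W \<omega>)) \<le> b} *
    measure P {\<omega> \<in> space P. enn2real (U_stat k f (W \<omega>)) >
       b + s * real k * sqrt (enn2real (local_sq k f (W \<omega>)))} \<le> exp (- (s\<^sup>2 / 4))"
    (is "measure P ?A * measure P ?B \<le> _")
proof (rule field_le_epsilon)
  fix e :: real assume e: "e > 0"
  interpret prob_space P using pp by (simp add: poisson_process_def)
  have \<eta>: "\<eta> \<in> measurable P config_space" and ind: "indep_counts P \<eta>"
    using pp by (auto simp: poisson_process_def indep_counts_def)
  have sets_\<mu>: "sets \<mu> = sets borel" using lf by (simp add: loc_finite_measure_def)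
  have f_meas: "f \<in> borel_measurable (PiM {..<k} (\<lambda>_. borel))" using f(1) by (simp add: sym_kernel_def)
  note [measurable] = measurable_U_stat[OF f_meas] measurable_local_sq[OF f_meas k]
  define K where "K = measure \<mu> (ball 0 R)"
  have ball_fin: "emeasure \<mu> (ball 0 R) < \<infinity>" using lf by (auto simp: loc_finite_measure_def)
  \<comment> \<open>A cell holds more than one point with probability at most the square of its
    measure, hence at most \<open>\<delta>\<close> times its measure. Summed over the cells this is
    \<open>\<delta> * K \<le> e\<close>; the \<open>+ 1\<close> guards against
    \<open>K = 0\<close>.\<close>
  define \<delta> where "\<delta> = e / (K + 1)"
  have K: "K \<ge> 0" by (simp add: K_def)
  have \<delta>: "\<delta> > 0" using e K by (simp add: \<delta>_def)
  have "\<delta> * K \<le> \<delta> * (K + 1)" using \<delta> by (intro mult_left_mono) auto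
  also have "\<dots> = e" using K by (simp add: \<delta>_def)
  finally have \<delta>K: "\<delta> * K \<le> e" .
  obtain C :: "nat \<Rightarrow> 'a set" and m where C: "\<And>i. C i \<in> sets borel" "disjoint_family C"
    "(\<Union>i<m. C i) = ball 0 R" "\<And>i. i < m \<Longrightarrow> emeasure \<mu> (C i) \<le> ennreal \<delta>" "0 < m"
    using fine_partition[OF lf na, of "ennreal \<delta>" R] \<delta> by auto
  define X where "X i \<omega> = \<eta> \<omega> \<inter> C i" for i \<omega>
  have X: "X i \<in> measurable P config_space" for i
    unfolding X_def by (rule measurable_compose[OF \<eta> measurable_Int_config_space[OF C(1)]])
  define M where "M i = distr P config_space (X i)" for i
  have M: "prob_space (M i)" for i unfolding M_def by (rule prob_space_distr[OF X])
  have sets_M: "sets (M i) = sets config_space" for i by (simp add: M_def)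
  have space_M: "space (M i) = loc_finite_sets" for i by (simp add: M_def space_config_space)
  define vec where "vec \<omega> = (\<lambda>i\<in>{..<m}. X i \<omega>)" for \<omega>
  have "indep_vars (\<lambda>_. config_space) X {..<m}"
    unfolding X_def using C by (intro indep_cells[OF ind \<eta>]) (auto simp: disjoint_family_on_def)
  then have distr: "distr P (PiM {..<m} (\<lambda>_. config_space)) vec = PiM {..<m} M"
    unfolding vec_def M_def using X C(5) by (subst (asm) indep_vars_iff_distr_eq_PiM') auto
  have sets_PiM_M: "sets (PiM {..<m} M) = sets (PiM {..<m} (\<lambda>_. config_space))"
    by (intro sets_PiM_cong sets_M refl)
  have vec: "vec \<in> measurable P (PiM {..<m} (\<lambda>_. config_space))"
    unfolding vec_def using X by (intro measurable_restrict)
  have glue_vec: "glue m C (vec \<omega>) = W \<omega>" for \<omega>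
    using C(3) by (auto simp: glue_def vec_def X_def W_def)
  define g where "g = glue m C"
  have [measurable]: "g \<in> measurable (PiM {..<m} M) config_space"
    unfolding g_def by (rule measurable_glue[OF C(1,2) sets_M])
  have [measurable]: "(\<lambda>x. pts_in (x i) (C i)) \<in> borel_measurable (PiM {..<m} M)" if "i \<in> {..<m}" for i
  proof (rule measurable_compose[OF measurable_component_singleton[OF that]])
    show "(\<lambda>\<xi>. pts_in \<xi> (C i)) \<in> borel_measurable (M i)"
      using measurable_pts_in[OF C(1)[of i]] measurable_cong_sets[OF sets_M refl] by blast
  qed
  define SA where "SA = {x \<in> space (PiM {..<m} M). enn2real (U_stat k f (g x)) \<le> b}"
  \<comment> \<open>Only the point that carries the weights has to have at most one point per cell;
    configurations in \<open>SA\<close> may be arbitrary. Hence the discretisation error affects the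
    second probability alone.\<close>
  define SB where "SB = {x \<in> space (PiM {..<m} M).
    enn2real (U_stat k f (g x)) > b + s * real k * sqrt (enn2real (local_sq k f (g x))) \<and>
    (\<forall>i\<in>{..<m}. pts_in (x i) (C i) \<le> 1)}"
  have SA: "SA \<in> sets (PiM {..<m} M)" unfolding SA_def by measurable
  have SB: "SB \<in> sets (PiM {..<m} M)" unfolding SB_def by measurable
  have fin: "finite (x i \<inter> C i)" if "x \<in> space (PiM {..<m} M)" "i < m" for x i
  proof -
    have "x i \<in> loc_finite_sets"
      using that by (auto simp: space_PiM space_M dest: PiE_mem)
    then have "finite (x i \<inter> ball 0 R)" by (simp add: loc_finite_sets_def)
    then show ?thesis using C(3) that by (auto intro: finite_subset[of _ "x i \<inter> ball 0 R"])
  qed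
  have fin_g: "finite (g x)" if "x \<in> space (PiM {..<m} M)" for x
    using fin[OF that] by (simp add: g_def glue_def)
  have U_g: "enn2real (U_stat k f (g x)) = U_sum k f (g x)"
    and V_g: "enn2real (local_sq k f (g x)) = (\<Sum>z\<in>g x. (U_sum_local k f z (g x))\<^sup>2)"
    if "x \<in> space (PiM {..<m} M)" for x
    using U_stat_finite[OF k f fin_g[OF that]] local_sq_finite[OF k f fin_g[OF that]]
      U_sum_nonneg[OF k f, of "g x"] by (auto simp: sum_nonneg)
  have "measure (PiM {..<m} M) SA * measure (PiM {..<m} M) SB \<le> exp (- (s\<^sup>2 / 4))"
  proof (rule talagrand_convex_distance[OF M _ SA SB s])
    fix x assume x: "x \<in> SB"
    then have x': "x \<in> space (PiM {..<m} M)" by (simp add: SB_def)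
    show "\<exists>u. (\<forall>i\<in>{..<m}. u i \<ge> 0) \<and> (\<Sum>i<m. (u i)\<^sup>2) \<le> 1 \<and>
       (\<forall>y\<in>SA. s \<le> (\<Sum>i<m. if y i \<noteq> x i then u i else 0))"
    proof (rule U_sum_cells[OF k f C(2) fin[OF x'] _ s])
      show "card (x i \<inter> C i) \<le> 1" if "i < m" for i
      proof -
        have "pts_in (x i) (C i) \<le> 1" using x that by (simp add: SB_def)
        then have "of_nat (card (x i \<inter> C i)) \<le> (1 :: ennreal)"
          using fin[OF x' that] by (simp add: pts_in_def)
        then show ?thesis by simp
      qed
      show "b + s * real k * sqrt (\<Sum>z\<in>glue m C x. (U_sum_local k f z (glue m C x))\<^sup>2) < U_sum k f (glue m C x)"
        using x U_g[OF x'] V_g[OF x'] by (simp add: SB_def g_def)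
      show "U_sum k f (glue m C y) \<le> b \<and> finite (glue m C y)" if "y \<in> SA" for y
        using that U_g[of y] fin_g[of y] by (simp add: SA_def g_def)
    qed
  qed auto
  moreover have meas: "measure (PiM {..<m} M) S = prob {\<omega> \<in> space P. vec \<omega> \<in> S}"
    if "S \<in> sets (PiM {..<m} M)" for S
  proof -
    have "measure (PiM {..<m} M) S = prob (vec -` S \<inter> space P)"
      unfolding distr[symmetric] using that sets_PiM_M by (intro measure_distr vec) simp
    also have "vec -` S \<inter> space P = {\<omega> \<in> space P. vec \<omega> \<in> S}" by auto
    finally show ?thesis .
  qed
  moreover have vec_space: "vec \<omega> \<in> space (PiM {..<m} M)" if "\<omega> \<in> space P" for \<omega>
    using measurable_space[OF vec that] sets_eq_imp_space_eq[OF sets_PiM_M] by simp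
  moreover have "{\<omega> \<in> space P. vec \<omega> \<in> SA} = ?A"
    using vec_space by (auto simp: SA_def g_def glue_vec)
  ultimately have main: "prob ?A * prob {\<omega> \<in> space P. vec \<omega> \<in> SB} \<le> exp (- (s\<^sup>2 / 4))"
    using SA SB by simp
  define bad where "bad i = {\<omega> \<in> space P. \<not> pts_in (\<eta> \<omega>) (C i) \<le> 1}" for i
  have pts_vec: "pts_in (vec \<omega> i) (C i) = pts_in (\<eta> \<omega>) (C i)" if "i < m" for i \<omega>
    using that by (simp add: vec_def X_def pts_in_Int)
  have bad_meas: "bad i \<in> events" for i
    using measurable_compose[OF \<eta> measurable_pts_in[OF C(1)[of i]]] unfolding bad_def by measurable
  have vecSB_meas: "{\<omega> \<in> space P. vec \<omega> \<in> SB} \<in> events"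
  proof -
    have "vec -` SB \<inter> space P \<in> events" using SB sets_PiM_M by (intro measurable_sets[OF vec]) simp
    also have "vec -` SB \<inter> space P = {\<omega> \<in> space P. vec \<omega> \<in> SB}" by auto
    finally show ?thesis .
  qed
  have "?B \<subseteq> {\<omega> \<in> space P. vec \<omega> \<in> SB} \<union> (\<Union>i<m. bad i)"
    using vec_space by (auto simp: SB_def g_def glue_vec bad_def pts_vec)
  then have "prob ?B \<le> prob ({\<omega> \<in> space P. vec \<omega> \<in> SB} \<union> (\<Union>i<m. bad i))"
    using bad_meas vecSB_meas by (intro finite_measure_mono) auto
  also have "\<dots> \<le> prob {\<omega> \<in> space P. vec \<omega> \<in> SB} + prob (\<Union>i<m. bad i)"
    using bad_meas vecSB_meas by (intro measure_Un_le) auto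
  also have "prob (\<Union>i<m. bad i) \<le> (\<Sum>i<m. prob (bad i))"
    using bad_meas by (intro measure_UNION_le) auto
  also have "\<dots> \<le> (\<Sum>i<m. \<delta> * measure \<mu> (C i))"
  proof (rule sum_mono)
    fix i assume i: "i \<in> {..<m}"
    have fin_C: "emeasure \<mu> (C i) < \<infinity>" using C(4)[of i] i by (auto intro: le_less_trans)
    then have "measure \<mu> (C i) \<le> \<delta>"
      using C(4)[of i] i \<delta> by (auto simp: measure_def intro!: enn2real_leI)
    then show "prob (bad i) \<le> \<delta> * measure \<mu> (C i)"
      unfolding bad_def using poisson_two_points[OF pp C(1) fin_C]
      by (elim order_trans) (simp add: power2_eq_square mult_right_mono)
  qed
  also have "\<dots> = \<delta> * measure \<mu> (\<Union>i<m. C i)"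
  proof -
    have "measure \<mu> (\<Union>i<m. C i) = (\<Sum>i<m. measure \<mu> (C i))"
    proof (rule measure_finite_Union)
      show "C ` {..<m} \<subseteq> sets \<mu>" using C(1) by (auto simp: sets_\<mu>)
      show "disjoint_family_on C {..<m}" using C(2) by (auto simp: disjoint_family_on_def)
      show "emeasure \<mu> (C i) \<noteq> \<infinity>" if "i \<in> {..<m}" for i
        using C(4)[of i] that by (auto simp: top_unique)
    qed simp
    then show ?thesis by (simp add: sum_distrib_left)
  qed
  finally have "prob ?B \<le> prob {\<omega> \<in> space P. vec \<omega> \<in> SB} + e"
    using \<delta>K by (simp add: C(3) K_def)
  then have "prob ?A * prob ?B \<le> prob ?A * (prob {\<omega> \<in> space P. vec \<omega> \<in> SB} + e)"
    by (rule mult_left_mono) (rule measure_nonneg)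
  also have "\<dots> = prob ?A * prob {\<omega> \<in> space P. vec \<omega> \<in> SB} + prob ?A * e"
    by (rule distrib_left)
  also have "prob ?A * e \<le> e"
    using e by (simp add: mult_left_le_one_le)
  finally show "prob ?A * prob ?B \<le> exp (- (s\<^sup>2 / 4)) + e"
    using main by simp
qed

text \<open>Up to null sets, the lower event is contained in that of every window, and the upper
  event in the lower limit of the window events: the threshold in a window never exceeds the full
  one, while the windowed statistic climbs to the full value. Finiteness of \<open>local_sq\<close>
  belongs to the event because \<open>enn2real\<close> maps infinity to 0, which would lower the
  threshold spuriously.\<close>

lemma poisson_U_concentration:
  fixes \<mu> :: "'a::euclidean_space measure" and \<eta> :: "'w \<Rightarrow> 'a set" and f :: "(nat \<Rightarrow> 'a) \<Rightarrow> real"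
    and b s :: real
  assumes lf: "loc_finite_measure \<mu>" and na: "non_atomic \<mu>"
    and pp: "poisson_process P \<eta> \<mu>"
    and k: "k \<ge> 1" and f: "sym_kernel k f" "\<And>x. x \<in> {..<k} \<rightarrow>\<^sub>E UNIV \<Longrightarrow> f x \<ge> 0"
    and fin: "AE \<omega> in P. U_stat k f (\<eta> \<omega>) < \<infinity>"
    and s: "s \<ge> 0"
  shows "measure P {\<omega> \<in> space P. enn2real (U_stat k f (\<eta> \<omega>)) \<le> b} *
    measure P {\<omega> \<in> space P. local_sq k f (\<eta> \<omega>) < \<infinity> \<and> enn2real (U_stat k f (\<eta> \<omega>)) >
       b + s * real k * sqrt (enn2real (local_sq k f (\<eta> \<omega>)))} \<le> exp (- (s\<^sup>2 / 4))"
    (is "measure P ?A * measure P ?B \<le> ?e")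
proof -
  interpret prob_space P using pp by (simp add: poisson_process_def)
  have \<eta>: "\<eta> \<in> measurable P config_space" using pp by (simp add: poisson_process_def)
  have \<eta>_lf: "\<eta> \<omega> \<in> loc_finite_sets" if "\<omega> \<in> space P" for \<omega>
    using measurable_space[OF \<eta> that] by (simp add: space_config_space)
  have f_meas: "f \<in> borel_measurable (PiM {..<k} (\<lambda>_. borel))" using f(1) by (simp add: sym_kernel_def)
  define W where "W n \<omega> = \<eta> \<omega> \<inter> ball 0 (real n)" for n \<omega>
  have W: "W n \<in> measurable P config_space" for n
    unfolding W_def by (rule measurable_compose[OF \<eta> measurable_Int_config_space]) simp
  note [measurable] = measurable_compose[OF \<eta> measurable_U_stat[OF f_meas]]
    measurable_compose[OF W measurable_U_stat[OF f_meas]]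
    measurable_compose[OF \<eta> measurable_local_sq[OF f_meas k]]
    measurable_compose[OF W measurable_local_sq[OF f_meas k]]
  define A where "A n = {\<omega> \<in> space P. enn2real (U_stat k f (W n \<omega>)) \<le> b}" for n
  define B where "B n = {\<omega> \<in> space P. enn2real (U_stat k f (W n \<omega>)) >
       b + s * real k * sqrt (enn2real (local_sq k f (W n \<omega>)))}" for n
  \<comment> \<open>The sets \<open>D n\<close> increase to the lower limit of the
    \<open>B n\<close>, which gives continuity from below although the \<open>B n\<close> themselves
    may not be monotone.\<close>
  define D where "D n = (\<Inter>m\<in>{n..}. B m)" for n
  have AB: "prob (A n) * prob (B n) \<le> ?e" for n
    unfolding A_def B_def W_def by (rule window_concentration[OF lf na pp k f s])
  have A_meas [measurable]: "A n \<in> events" for n unfolding A_def by measurable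
  have B_meas [measurable]: "B n \<in> events" for n unfolding B_def by measurable
  have D_meas [measurable]: "D n \<in> events" for n unfolding D_def by measurable
  have U_le: "U_stat k f (W n \<omega>) \<le> U_stat k f (\<eta> \<omega>)" for n \<omega>
    unfolding W_def by (rule U_stat_mono) simp
  have V_le: "local_sq k f (W n \<omega>) \<le> local_sq k f (\<eta> \<omega>)" for n \<omega>
    unfolding W_def by (rule local_sq_mono) simp
  have A_le: "prob ?A \<le> prob (A n)" for n
  proof (rule finite_measure_mono_AE)
    show "AE \<omega> in P. \<omega> \<in> ?A \<longrightarrow> \<omega> \<in> A n"
      using fin
    proof eventually_elim
      fix \<omega> assume "U_stat k f (\<eta> \<omega>) < \<infinity>"
      then have "enn2real (U_stat k f (W n \<omega>)) \<le> enn2real (U_stat k f (\<eta> \<omega>))"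
        using U_le by (intro enn2real_mono) auto
      then show "\<omega> \<in> ?A \<longrightarrow> \<omega> \<in> A n" by (auto simp: A_def)
    qed
  qed measurable
  have "prob ?B \<le> prob (\<Union>n. D n)"
  proof (rule finite_measure_mono_AE)
    show "AE \<omega> in P. \<omega> \<in> ?B \<longrightarrow> \<omega> \<in> (\<Union>n. D n)"
      using fin
    proof (eventually_elim, intro impI)
      fix \<omega> assume U: "U_stat k f (\<eta> \<omega>) < \<infinity>" and "\<omega> \<in> ?B"
      then have \<omega>: "\<omega> \<in> space P" and V: "local_sq k f (\<eta> \<omega>) < \<infinity>"
        and gt: "b + s * real k * sqrt (enn2real (local_sq k f (\<eta> \<omega>))) < enn2real (U_stat k f (\<eta> \<omega>))"
        by auto
      define t where "t = b + s * real k * sqrt (enn2real (local_sq k f (\<eta> \<omega>)))"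
      have "\<forall>\<^sub>F n in sequentially. t < enn2real (U_stat k f (W n \<omega>))"
      \<comment> \<open>A negative level is exceeded by every nonnegative value, but
        \<open>ennreal\<close> would turn it into 0 and lose the strict inequality.\<close>
      proof (cases "t < 0")
        case True
        then show ?thesis by (intro always_eventually allI) (rule less_le_trans, auto)
      next
        case False
        then have "ennreal t < ennreal (enn2real (U_stat k f (\<eta> \<omega>)))"
          using gt by (subst ennreal_less_iff) (auto simp: t_def)
        also have "\<dots> = U_stat k f (\<eta> \<omega>)" using U by simp
        finally have "ennreal t < U_stat k f (\<eta> \<omega>)" .
        from U_stat_ball_eventually_gt[OF this] show ?thesis
        proof eventually_elim
          fix n assume "ennreal t < U_stat k f (\<eta> \<omega> \<inter> ball 0 (real n))"
          moreover have "U_stat k f (W n \<omega>) < \<infinity>" using U_le U by (rule le_less_trans)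
          then have "U_stat k f (W n \<omega>) = ennreal (enn2real (U_stat k f (W n \<omega>)))" by simp
          ultimately have "ennreal t < ennreal (enn2real (U_stat k f (W n \<omega>)))" by (simp add: W_def)
          then show "t < enn2real (U_stat k f (W n \<omega>))"
            using False by (subst (asm) ennreal_less_iff) auto
        qed
      qed
      then obtain N where N: "\<And>n. n \<ge> N \<Longrightarrow> t < enn2real (U_stat k f (W n \<omega>))"
        by (auto simp: eventually_sequentially)
      have "\<omega> \<in> B n" if "n \<ge> N" for n
      proof -
        have "sqrt (enn2real (local_sq k f (W n \<omega>))) \<le> sqrt (enn2real (local_sq k f (\<eta> \<omega>)))"
          using V_le V by (intro real_sqrt_le_mono enn2real_mono) auto
        then have "b + s * real k * sqrt (enn2real (local_sq k f (W n \<omega>))) \<le> t"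
          unfolding t_def using s by (intro add_left_mono mult_left_mono) auto
        also note N[OF that]
        finally show ?thesis using \<omega> by (simp add: B_def)
      qed
      then show "\<omega> \<in> (\<Union>n. D n)" by (auto simp: D_def)
    qed
  qed measurable
  moreover have "(\<lambda>n. prob (D n)) \<longlonglongrightarrow> prob (\<Union>n. D n)"
    by (rule finite_Lim_measure_incseq) (auto simp: incseq_def D_def)
  then have "(\<lambda>n. prob ?A * prob (D n)) \<longlonglongrightarrow> prob ?A * prob (\<Union>n. D n)"
    by (rule tendsto_mult_left)
  then have "prob ?A * prob (\<Union>n. D n) \<le> ?e"
  proof (rule LIMSEQ_le_const2, intro exI allI impI)
    fix n
    have "prob ?A * prob (D n) \<le> prob (A n) * prob (B n)"
    proof (rule mult_mono)
      show "prob (D n) \<le> prob (B n)" by (rule finite_measure_mono) (auto simp: D_def)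
    qed (use A_le in auto)
    also note AB
    finally show "prob ?A * prob (D n) \<le> ?e" .
  qed
  ultimately show ?thesis
    by (meson measure_nonneg mult_left_mono order_trans)
qed

section \<open>Deviation from the median\<close>

text \<open>Right continuity of the distribution function at the infimum gives the first bound. The
  second follows from the left limit, since to the left of the infimum the distribution function is
  at most 1/2.\<close>

lemma (in prob_space) smallest_median:
  fixes Z :: "'a \<Rightarrow> real"
  assumes Z: "Z \<in> borel_measurable M"
  shows "1 / 2 \<le> prob {\<omega> \<in> space M. Z \<omega> \<le> smallest_median M Z}"
    and "1 / 2 \<le> prob {\<omega> \<in> space M. smallest_median M Z \<le> Z \<omega>}"
proof -
  interpret D: real_distribution "distr M borel Z" using Z by (rule real_distribution_distr)
  let ?c = "cdf (distr M borel Z)" and ?m = "smallest_median M Z"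
  have c: "?c x = prob {\<omega> \<in> space M. Z \<omega> \<le> x}" for x
    using Z by (subst cdf_def, subst measure_distr) (auto intro!: arg_cong[where f=prob])
  have m: "?m = Inf {x. 1 / 2 \<le> ?c x}" by (simp add: smallest_median_def c)
  have "eventually (\<lambda>x. 1 / 2 < ?c x) at_top"
    by (rule order_tendstoD(1)[OF D.cdf_lim_at_top_prob]) simp
  then have ne: "{x. 1 / 2 \<le> ?c x} \<noteq> {}"
    by (auto simp: eventually_at_top_linorder intro: less_imp_le)
  have "eventually (\<lambda>x. ?c x < 1 / 2) at_bot"
    by (rule order_tendstoD(2)[OF D.cdf_lim_at_bot]) simp
  then obtain l where l: "\<And>x. x \<le> l \<Longrightarrow> ?c x < 1 / 2"
    by (auto simp: eventually_at_bot_linorder)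
  have bdd: "bdd_below {x. 1 / 2 \<le> ?c x}"
  proof (rule bdd_belowI)
    fix x assume "x \<in> {x. 1 / 2 \<le> ?c x}"
    then show "l \<le> x" using l[of x] by force
  qed
  have gt: "1 / 2 \<le> ?c x" if "?m < x" for x
  proof -
    from cInf_lessD[OF ne that[unfolded m]]
    obtain y where "1 / 2 \<le> ?c y" "y < x" by blast
    then show ?thesis using D.cdf_nondecreasing[of y x] by simp
  qed
  have lt: "?c x \<le> 1 / 2" if "x < ?m" for x
    using that cInf_lower[OF _ bdd, of x] unfolding m by force
  have "(?c \<longlongrightarrow> ?c ?m) (at_right ?m)"
    using D.cdf_is_right_cont by (simp add: continuous_within)
  moreover have "\<forall>\<^sub>F x in at_right ?m. 1 / 2 \<le> ?c x"
    by (rule eventually_mono[OF eventually_at_right_less]) (rule gt)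
  ultimately have "1 / 2 \<le> ?c ?m"
    by (rule tendsto_lowerbound) simp
  then show "1 / 2 \<le> prob {\<omega> \<in> space M. Z \<omega> \<le> ?m}" by (simp add: c)
  have "(?c \<longlongrightarrow> measure (distr M borel Z) {..<?m}) (at_left ?m)"
    by (rule D.cdf_at_left)
  moreover have "\<forall>\<^sub>F x in at_left ?m. ?c x \<le> 1 / 2"
    by (rule eventually_mono[OF eventually_at_left_real[of "?m - 1"]]) (simp, rule lt, simp)
  ultimately have "measure (distr M borel Z) {..<?m} \<le> 1 / 2"
    by (rule tendsto_upperbound) simp
  moreover have "measure (distr M borel Z) {..<?m} = prob {\<omega> \<in> space M. Z \<omega> < ?m}"
    using Z by (subst measure_distr) (auto intro!: arg_cong[where f=prob])
  moreover have "prob {\<omega> \<in> space M. \<not> Z \<omega> < ?m} = 1 - prob {\<omega> \<in> space M. Z \<omega> < ?m}"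
    using Z by (intro prob_neg) measurable
  ultimately show "1 / 2 \<le> prob {\<omega> \<in> space M. ?m \<le> Z \<omega>}"
    by (simp add: not_less)
qed

section \<open>Powers and exponents under the degenerate conventions\<close>

lemma rpow_nonneg: "0 \<le> rpow x a"
  by (simp add: rpow_def)

lemma rpow_pos: "0 < x \<Longrightarrow> 0 < rpow x a"
  by (simp add: rpow_def)

text \<open>For positive \<open>x\<close>, \<open>sqrt (c * rpow x a) / x\<close> is a constant
  times \<open>x powr (a / 2 - 1)\<close>, which is strictly decreasing because
  \<open>a < 2\<close>.\<close>

lemma sqrt_rpow_le:
  assumes "0 < y" "y \<le> x" "0 \<le> a" "a < 2" "0 < c"
  shows "sqrt (c * rpow x a) \<le> x / y * sqrt (c * rpow y a)"
    and "y < x \<Longrightarrow> sqrt (c * rpow x a) < x / y * sqrt (c * rpow y a)"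
proof -
  have eq: "rpow z a = z powr a" if "0 < z" for z using that by (simp add: rpow_def)
  have "c * rpow x a = (x / y) powr a * (c * rpow y a)"
    using assms by (simp add: eq powr_divide)
  then have *: "sqrt (c * rpow x a) = sqrt ((x / y) powr a) * sqrt (c * rpow y a)"
    by (simp only: real_sqrt_mult[symmetric])
  have q: "sqrt ((x / y) powr 2) = x / y" using assms by simp
  have "(x / y) powr a \<le> (x / y) powr 2" using assms by (intro powr_mono) auto
  then have "sqrt ((x / y) powr a) \<le> x / y" by (metis q real_sqrt_le_mono)
  then show "sqrt (c * rpow x a) \<le> x / y * sqrt (c * rpow y a)"
    unfolding * using assms by (intro mult_right_mono) (auto simp: rpow_nonneg)
  assume "y < x"
  then have "(x / y) powr a < (x / y) powr 2" using assms by (intro powr_less_mono) auto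
  then have "sqrt ((x / y) powr a) < x / y" by (metis q real_sqrt_less_mono)
  then show "sqrt (c * rpow x a) < x / y * sqrt (c * rpow y a)"
    unfolding * using assms rpow_pos[of y a] by (intro mult_strict_right_mono) auto
qed

lemma exp_neg_quot_nonneg: "0 \<le> exp_neg_quot p q"
  by (simp add: exp_neg_quot_def Let_def)

lemma exp_neg_quot_0: "exp_neg_quot 0 q = 1"
proof -
  have "ereal 0 / ereal q = 0" by (simp flip: zero_ereal_def)
  then show ?thesis by (simp add: exp_neg_quot_def)
qed

lemma exp_neg_quot_pos: "0 < q \<Longrightarrow> exp_neg_quot p q = exp (- (p / q))"
  by (simp add: exp_neg_quot_def)

theorem theorem3p2:
  fixes P :: "'w measure"
    and \<eta> :: "'w \<Rightarrow> 'a::euclidean_space set"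
    and \<mu> :: "'a measure"
    and k :: nat
    and f :: "(nat \<Rightarrow> 'a) \<Rightarrow> real"
    and F :: "'w \<Rightarrow> real"
    and \<alpha> c r :: real
  defines "F \<equiv> \<lambda>\<omega>. enn2real (U_stat k f (\<eta> \<omega>))"
  assumes "loc_finite_measure \<mu>" and "non_atomic \<mu>" and "emeasure \<mu> UNIV \<noteq> 0"
    and "poisson_process P \<eta> \<mu>"
    and "k \<ge> 1"
    and "sym_kernel k f"
    and "\<And>x. x \<in> {..<k} \<rightarrow>\<^sub>E UNIV \<Longrightarrow> f x \<ge> 0"
    and "AE \<omega> in P. U_stat k f (\<eta> \<omega>) < \<infinity>"
    and "0 \<le> \<alpha>" and "\<alpha> < 2" and "c > 0"
    and "AE \<omega> in P. (\<Sum>\<^sub>\<infinity>x\<in>\<eta> \<omega>. (U_stat_local k f x (\<eta> \<omega>))\<^sup>2) \<le> ennreal (c * rpow (F \<omega>) \<alpha>)"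
    and "r \<ge> 0"
  shows "measure P {\<omega> \<in> space P. F \<omega> > smallest_median P F + r}
           \<le> 2 * exp_neg_quot (r\<^sup>2) (4 * (real k)\<^sup>2 * c * rpow (r + smallest_median P F) \<alpha>) \<and>
         measure P {\<omega> \<in> space P. F \<omega> < smallest_median P F - r}
           \<le> 2 * exp_neg_quot (r\<^sup>2) (4 * (real k)\<^sup>2 * c * rpow (smallest_median P F) \<alpha>)"
proof -
  interpret prob_space P using assms(5) by (simp add: poisson_process_def)
  have \<eta>: "\<eta> \<in> measurable P config_space" using assms(5) by (simp add: poisson_process_def)
  have f_meas: "f \<in> borel_measurable (PiM {..<k} (\<lambda>_. borel))"
    using assms(7) by (simp add: sym_kernel_def)
  define V where "V \<omega> = local_sq k f (\<eta> \<omega>)" for \<omega>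
  have F_meas [measurable]: "F \<in> borel_measurable P"
    unfolding F_def using measurable_compose[OF \<eta> measurable_U_stat[OF f_meas]] by measurable
  have V_meas [measurable]: "V \<in> borel_measurable P"
    unfolding V_def by (rule measurable_compose[OF \<eta> measurable_local_sq[OF f_meas assms(6)]])
  have F_nonneg: "0 \<le> F \<omega>" for \<omega> by (simp add: F_def)
  define m where "m = smallest_median P F"
  have med: "1 / 2 \<le> prob {\<omega> \<in> space P. F \<omega> \<le> m}" "1 / 2 \<le> prob {\<omega> \<in> space P. m \<le> F \<omega>}"
    unfolding m_def by (rule smallest_median[OF F_meas])+
  have m_nonneg: "0 \<le> m"
  proof (rule ccontr)
    assume "\<not> 0 \<le> m"
    then have "{\<omega> \<in> space P. F \<omega> \<le> m} = {}" using F_nonneg by (auto intro: order_trans)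
    then show False using med(1) by (simp only: measure_empty)
  qed
  have V_le: "AE \<omega> in P. V \<omega> < \<infinity> \<and> sqrt (enn2real (V \<omega>)) \<le> sqrt (c * rpow (F \<omega>) \<alpha>)"
    using assms(13)
  proof eventually_elim
    fix \<omega> assume "(\<Sum>\<^sub>\<infinity>x\<in>\<eta> \<omega>. (U_stat_local k f x (\<eta> \<omega>))\<^sup>2) \<le> ennreal (c * rpow (F \<omega>) \<alpha>)"
    then have V: "V \<omega> \<le> ennreal (c * rpow (F \<omega>) \<alpha>)" by (simp add: V_def local_sq_def)
    then have "enn2real (V \<omega>) \<le> c * rpow (F \<omega>) \<alpha>"
      using assms(12) rpow_nonneg by (intro enn2real_leI) auto
    moreover have "V \<omega> < \<infinity>" using V by (rule le_less_trans) simp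
    ultimately show "V \<omega> < \<infinity> \<and> sqrt (enn2real (V \<omega>)) \<le> sqrt (c * rpow (F \<omega>) \<alpha>)" by simp
  qed
  have conc: "prob {\<omega> \<in> space P. F \<omega> \<le> b} *
      prob {\<omega> \<in> space P. V \<omega> < \<infinity> \<and> b + s * real k * sqrt (enn2real (V \<omega>)) < F \<omega>} \<le> exp (- (s\<^sup>2 / 4))"
    if "0 \<le> s" for b s
    using poisson_U_concentration[OF assms(2,3,5-9) that, of b] by (simp add: F_def V_def)
  \<comment> \<open>On this scale the exponent of the theorem reads \<open>(r / Q y)^2 / 4\<close>,
    so \<open>conc\<close> is to be applied with \<open>s = r / Q y\<close>.\<close>
  define Q where "Q y = real k * sqrt (c * rpow y \<alpha>)" for y
  have Q_pos: "Q y > 0" if "y > 0" for y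
    using assms(6,12) rpow_pos[OF that] by (simp add: Q_def)
  have Q_bound: "exp_neg_quot (r\<^sup>2) (4 * (real k)\<^sup>2 * c * rpow y \<alpha>) = exp (- ((r / Q y)\<^sup>2 / 4))" if "y > 0" for y
  proof -
    have "4 * (real k)\<^sup>2 * c * rpow y \<alpha> = 4 * (Q y)\<^sup>2"
      using assms(12) rpow_nonneg[of y \<alpha>] by (simp add: Q_def power_mult_distrib)
    moreover have "r\<^sup>2 / (4 * (Q y)\<^sup>2) = (r / Q y)\<^sup>2 / 4" by (simp add: power_divide)
    moreover have "exp_neg_quot (r\<^sup>2) (4 * (Q y)\<^sup>2) = exp (- (r\<^sup>2 / (4 * (Q y)\<^sup>2)))"
      using Q_pos[OF that] by (intro exp_neg_quot_pos) simp
    ultimately show ?thesis by (simp only:)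
  qed
  show ?thesis
  \<comment> \<open>For \<open>r = 0\<close> the quotient is 0, even in the form 0/0, and both
    bounds equal 2. For \<open>r > 0\<close> the number \<open>r + m\<close> is positive even when
    the median is 0.\<close>
  proof (cases "r = 0")
    case True
    have "prob S \<le> 2" for S by (rule order_trans[OF prob_le_1]) simp
    with True show ?thesis by (simp add: exp_neg_quot_0)
  next
    case False
    with assms(14) have r: "0 < r" by simp
    have "prob {\<omega> \<in> space P. m + r < F \<omega>} \<le> 2 * exp (- ((r / Q (r + m))\<^sup>2 / 4))"
    proof -
      \<comment> \<open>Calibrated so that \<open>m + s * Q x\<close> equals \<open>x\<close> at
        \<open>x = r + m\<close>. Beyond that point it stays below \<open>x\<close>, since
        \<open>Q\<close> grows more slowly than a linear function.\<close>
      define s where "s = r / Q (r + m)"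
      have mr: "0 < r + m" using r m_nonneg by simp
      have "prob {\<omega> \<in> space P. m + r < F \<omega>} \<le>
          prob {\<omega> \<in> space P. V \<omega> < \<infinity> \<and> m + s * real k * sqrt (enn2real (V \<omega>)) < F \<omega>}" (is "_ \<le> prob ?B")
      proof (rule finite_measure_mono_AE)
        show "AE \<omega> in P. \<omega> \<in> {\<omega> \<in> space P. m + r < F \<omega>} \<longrightarrow> \<omega> \<in> ?B"
          using V_le
        proof (eventually_elim, intro impI)
          fix \<omega> assume V: "V \<omega> < \<infinity> \<and> sqrt (enn2real (V \<omega>)) \<le> sqrt (c * rpow (F \<omega>) \<alpha>)"
            and "\<omega> \<in> {\<omega> \<in> space P. m + r < F \<omega>}"
          then have \<omega>: "\<omega> \<in> space P" and gt: "r + m < F \<omega>" by auto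
          have "s * real k * sqrt (enn2real (V \<omega>)) \<le> s * (real k * sqrt (c * rpow (F \<omega>) \<alpha>))"
            unfolding mult.assoc using V r Q_pos[OF mr] by (intro mult_left_mono) (auto simp: s_def)
          also have "\<dots> < s * (real k * (F \<omega> / (r + m) * sqrt (c * rpow (r + m) \<alpha>)))"
            using sqrt_rpow_le(2)[OF mr _ assms(10-12) gt] gt assms(6) r Q_pos[OF mr]
            by (intro mult_strict_left_mono) (auto simp: s_def)
          also have "\<dots> = s * Q (r + m) * (F \<omega> / (r + m))"
            by (simp only: Q_def mult_ac)
          also have "s * Q (r + m) = r"
            using Q_pos[OF mr] by (simp add: s_def)
          also have "r * (F \<omega> / (r + m)) \<le> F \<omega> - m"
          proof -
            have "m * (r + m) \<le> m * F \<omega>" using gt m_nonneg by (intro mult_left_mono) auto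
            then have "r * F \<omega> \<le> (F \<omega> - m) * (r + m)" by (simp add: algebra_simps)
            then show ?thesis using mr by (simp only: times_divide_eq_right pos_divide_le_eq)
          qed
          finally show "\<omega> \<in> ?B" using \<omega> V by simp
        qed
      qed measurable
      moreover have "prob {\<omega> \<in> space P. F \<omega> \<le> m} * prob ?B \<le> exp (- (s\<^sup>2 / 4))"
        using r Q_pos[OF mr] by (intro conc) (simp add: s_def)
      moreover have "1 / 2 * prob ?B \<le> prob {\<omega> \<in> space P. F \<omega> \<le> m} * prob ?B"
        using med(1) by (rule mult_right_mono) simp
      ultimately show ?thesis by (simp add: s_def)
    qed
    moreover have "prob {\<omega> \<in> space P. F \<omega> < m - r} \<le>
      2 * exp_neg_quot (r\<^sup>2) (4 * (real k)\<^sup>2 * c * rpow m \<alpha>)"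
    \<comment> \<open>Here the event is empty because \<open>F\<close> is nonnegative. This includes
      \<open>m = 0\<close>, where for positive \<open>\<alpha>\<close> the right-hand side is
      0.\<close>
    proof (cases "m \<le> r")
      case True
      then have "{\<omega> \<in> space P. F \<omega> < m - r} = {}" using F_nonneg by (auto simp: not_less intro: order_trans[of _ 0])
      then have "prob {\<omega> \<in> space P. F \<omega> < m - r} = 0" by (simp only: measure_empty)
      then show ?thesis by (simp add: exp_neg_quot_nonneg)
    next
      case False
      then have m: "0 < m" using r by simp
      let ?p = "prob {\<omega> \<in> space P. F \<omega> < m - r}"
      define s where "s = r / Q m"
      have s: "0 < s" using r Q_pos[OF m] by (simp add: s_def)
      \<comment> \<open>Now \<open>m \<le> F\<close>, of probability at least 1/2, plays the upper
        event and the deviation is the lower one. At \<open>F = m\<close> the comparison with the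
        full \<open>s\<close> can be an equality, while \<open>conc\<close> has a strict inequality;
        the factor \<open>t < 1\<close> restores strictness and tends to 1 afterwards.\<close>
      have le: "1 / 2 * ?p \<le> exp (- ((t * s)\<^sup>2 / 4))" if t: "0 < t" "t < 1" for t
      proof -
        have "prob {\<omega> \<in> space P. m \<le> F \<omega>} \<le>
          prob {\<omega> \<in> space P. V \<omega> < \<infinity> \<and> (m - r) + t * s * real k * sqrt (enn2real (V \<omega>)) < F \<omega>}" (is "_ \<le> prob ?B")
        proof (rule finite_measure_mono_AE)
          show "AE \<omega> in P. \<omega> \<in> {\<omega> \<in> space P. m \<le> F \<omega>} \<longrightarrow> \<omega> \<in> ?B"
            using V_le
          proof (eventually_elim, intro impI)
            fix \<omega> assume V: "V \<omega> < \<infinity> \<and> sqrt (enn2real (V \<omega>)) \<le> sqrt (c * rpow (F \<omega>) \<alpha>)"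
              and "\<omega> \<in> {\<omega> \<in> space P. m \<le> F \<omega>}"
            then have \<omega>: "\<omega> \<in> space P" and ge: "m \<le> F \<omega>" by auto
            have "sqrt (enn2real (V \<omega>)) \<le> F \<omega> / m * sqrt (c * rpow m \<alpha>)"
              by (rule order_trans[OF conjunct2[OF V] sqrt_rpow_le(1)[OF m ge assms(10-12)]])
            then have "t * s * real k * sqrt (enn2real (V \<omega>)) \<le> t * s * real k * (F \<omega> / m * sqrt (c * rpow m \<alpha>))"
              using t s by (intro mult_left_mono) auto
            also have "\<dots> = t * (s * Q m * (F \<omega> / m))"
              by (simp only: Q_def mult_ac)
            also have "s * Q m = r"
              using Q_pos[OF m] by (simp add: s_def)
            also have "t * (r * (F \<omega> / m)) < 1 * (r * (F \<omega> / m))"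
              using t r m ge by (intro mult_strict_right_mono) auto
            also have "\<dots> \<le> F \<omega> - (m - r)"
            proof -
              have "0 \<le> (m - r) * (F \<omega> - m)" using False ge by simp
              then show ?thesis using m by (simp add: field_simps)
            qed
            finally show "\<omega> \<in> ?B" using \<omega> V by simp
          qed
        qed measurable
        with med(2) have B: "1 / 2 \<le> prob ?B" by simp
        have "1 / 2 * ?p \<le> prob ?B * prob {\<omega> \<in> space P. F \<omega> \<le> m - r}"
          using B by (intro mult_mono finite_measure_mono) auto
        also have "\<dots> \<le> exp (- ((t * s)\<^sup>2 / 4))"
          using conc[of "t * s" "m - r"] t s by (simp add: mult.commute)
        finally show ?thesis .
      qed
      have "((\<lambda>t. exp (- ((t * s)\<^sup>2 / 4))) \<longlongrightarrow> exp (- ((1 * s)\<^sup>2 / 4))) (at_left 1)"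
        by (intro tendsto_intros) auto
      moreover have "\<forall>\<^sub>F t in at_left 1. 1 / 2 * ?p \<le> exp (- ((t * s)\<^sup>2 / 4))"
        by (rule eventually_mono[OF eventually_at_left_real[of 0]]) (simp, rule le, auto)
      ultimately have "1 / 2 * ?p \<le> exp (- ((1 * s)\<^sup>2 / 4))"
        by (rule tendsto_lowerbound) simp
      then show ?thesis by (simp add: Q_bound[OF m] s_def)
    qed
    ultimately show ?thesis
      using r m_nonneg by (simp add: Q_bound flip: m_def)
  qed
qed

end
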